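(* Let $T$ be a spherical random field with spectrum $C_{\ell\ell'mm'}$, whose Laplace series converges to $T(\mathbf{x})$ in $L^2(\Omega)$ at every $\mathbf{x}\in\mathbb{S}^2$. The pole $\mathbf{0}$ is a point of isotropy of $T$ if and only if, for all $\ell'\in\mathbb{N}$ and all $m'\ne0$ with $|m'|\le\ell'$, $$\sum_{\ell\in\mathbb{N}_0}\sqrt{2\ell+1}\;C_{\ell\ell'0m'}=0.$$
   Context: $(\theta,\varphi)$ are colatitude and longitude on the unit sphere $\mathbb{S}^2$; $\mathbf{0}$ is the pole $\theta=0$. A spherical random field is a real-valued zero-mean second-order random field $T$ on $\mathbb{S}^2$ with continuous, not identically constant covariance function $C$. The point $\mathbf{x}_0$ is a point of isotropy if $C(\mathbf{x}_0,\mathbf{x})=B_{\mathbf{x}_0}(\gamma(\mathbf{x}_0,\mathbf{x}))$ for some function $B_{\mathbf{x}_0}:[0,\pi]\to\mathbb{R}$ and all $\mathbf{x}$, where $\gamma$ is the great-circle distance. $Y_{\ell m}(\theta,\varphi)=e^{im\varphi}\left[\frac{(2\ell+1)(\ell-m)!}{4\pi(\ell+m)!}\right]^{1/2}P_\ell^m(\cos\theta)$ for $m\ge0$, $Y_{\ell(-m)}=(-1)^mY^*_{\ell m}$, are the orthonormal complex spherical harmonics; in particular $Y_{\ell m}(\mathbf{0})=\delta_m^0\sqrt{(2\ell+1)/(4\pi)}$. With $a_{\ell m}=\int_{\mathbb{S}^2}T\,Y^*_{\ell m}\,d\mathbf{s}$ ($d\mathbf{s}$ surface measure), the spectrum is $C_{\ell\ell'mm'}=\mathbf{E}(a_{\ell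 m}a^*_{\ell'm'})$. The Laplace series of $T$ is $\sum_{\ell\in\mathbb{N}_0}\sum_{m=-\ell}^{\ell}a_{\ell m}Y_{\ell m}(\mathbf{x})$, with partial sums over $\ell\le L$, $L\to\infty$. *)

theory Defs
  imports "HOL-Probability.Probability" "HOL-Computational_Algebra.Polynomial"
begin

abbreviation unit_sphere :: "(real^3) set" where
  "unit_sphere \<equiv> sphere 0 1"

definition sphere_point :: "real \<Rightarrow> real \<Rightarrow> real^3" where
  "sphere_point \<theta> \<phi> = vector [sin \<theta> * cos \<phi>, sin \<theta> * sin \<phi>, cos \<theta>]"

definition north_pole :: "real^3" where
  "north_pole = vector [0, 0, 1]"

definition colatitude :: "real^3 \<Rightarrow> real" where
  "colatitude x = arccos (x $ 3)"

text \<open>Longitude in \<open>[0, 2\<pi>)\<close>; at the two poles it is \<open>Arg2pi 0 = 0\<close>. This choice is immaterial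
  below, because the spherical harmonics of nonzero order vanish at the poles.\<close>
definition longitude :: "real^3 \<Rightarrow> real" where
  "longitude x = Arg2pi (Complex (x $ 1) (x $ 2))"

text \<open>Great-circle distance; meaningful for points of the unit sphere only.\<close>
definition gc_dist :: "real^3 \<Rightarrow> real^3 \<Rightarrow> real" where
  "gc_dist x y = arccos (x \<bullet> y)"


text \<open>Legendre polynomials by Rodrigues' formula.\<close>
definition legendre :: "nat \<Rightarrow> real poly" where
  "legendre l = smult (1 / (2 ^ l * fact l)) ((pderiv ^^ l) ([:-1, 0, 1:] ^ l))"

text \<open>Associated Legendre functions on \<open>[-1, 1]\<close>, with the Condon--Shortley phase \<open>(-1)\<^sup>m\<close>.\<close>
definition assoc_legendre :: "nat \<Rightarrow> nat \<Rightarrow> real \<Rightarrow> real" where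
  "assoc_legendre l m t = (-1) ^ m * sqrt (1 - t\<^sup>2) ^ m * poly ((pderiv ^^ m) (legendre l)) t"

definition sph_harm_nonneg :: "nat \<Rightarrow> nat \<Rightarrow> real^3 \<Rightarrow> complex" where
  "sph_harm_nonneg l m x =
     cis (real m * longitude x) *
     complex_of_real
       (sqrt ((2 * real l + 1) * fact (l - m) / (4 * pi * fact (l + m)))
        * assoc_legendre l m (cos (colatitude x)))"

text \<open>Only used for \<open>\<bar>m\<bar> \<le> l\<close>, so the subtraction of natural numbers in \<open>fact (l - m)\<close> never
  truncates.\<close>
definition sph_harm :: "nat \<Rightarrow> int \<Rightarrow> real^3 \<Rightarrow> complex" where
  "sph_harm l m x =
     (if m \<ge> 0 then sph_harm_nonneg l (nat m) x
      else (-1) ^ nat (-m) * cnj (sph_harm_nonneg l (nat (-m)) x))"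


definition square_integrable ::
  "'w measure \<Rightarrow> ('w \<Rightarrow> 'b::{banach, second_countable_topology}) \<Rightarrow> bool" where
  "square_integrable M X \<longleftrightarrow> X \<in> borel_measurable M \<and> integrable M (\<lambda>\<omega>. (norm (X \<omega>))\<^sup>2)"

definition converges_in_L2 ::
  "'w measure \<Rightarrow> (nat \<Rightarrow> 'w \<Rightarrow> 'b::{banach, second_countable_topology}) \<Rightarrow> ('w \<Rightarrow> 'b) \<Rightarrow> bool" where
  "converges_in_L2 M X Y \<longleftrightarrow>
     (\<forall>n. square_integrable M (X n)) \<and> square_integrable M Y \<and>
     (\<lambda>n. \<integral>\<omega>. (norm (X n \<omega> - Y \<omega>))\<^sup>2 \<partial>M) \<longlonglongrightarrow> 0"

text \<open>Integral of a family of square-integrable random variables over a box, in the mean-square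
  sense: the gauge (Henstock--Kurzweil) integral underlying \<open>has_integral\<close>, with Riemann sums
  converging in the norm of \<open>L\<^sup>2(M)\<close>. For a mean-square continuous family this is the usual
  mean-square Riemann integral; no joint measurability of the family is needed. The value is
  determined only up to almost sure equality.\<close>
definition has_ms_integral ::
  "'w measure \<Rightarrow> ('n::euclidean_space \<Rightarrow> 'w \<Rightarrow> 'b::{banach, second_countable_topology}) \<Rightarrow>
   ('w \<Rightarrow> 'b) \<Rightarrow> 'n \<Rightarrow> 'n \<Rightarrow> bool" where
  "has_ms_integral M f I a b \<longleftrightarrow>
     (\<forall>s\<in>cbox a b. square_integrable M (f s)) \<and> square_integrable M I \<and>
     (\<forall>e>0. \<exists>\<gamma>. gauge \<gamma> \<and>
       (\<forall>D. D tagged_division_of cbox a b \<and> \<gamma> fine D \<longrightarrow>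
         (\<integral>\<omega>. (norm ((\<Sum>(s, k)\<in>D. measure lborel k *\<^sub>R f s \<omega>) - I \<omega>))\<^sup>2 \<partial>M) < e))"

definition ms_integral ::
  "'w measure \<Rightarrow> 'n::euclidean_space \<Rightarrow> 'n \<Rightarrow>
   ('n \<Rightarrow> 'w \<Rightarrow> 'b::{banach, second_countable_topology}) \<Rightarrow> 'w \<Rightarrow> 'b" where
  "ms_integral M a b f = (SOME I. has_ms_integral M f I a b)"


definition covariance :: "'w measure \<Rightarrow> ('w \<Rightarrow> real) \<Rightarrow> ('w \<Rightarrow> real) \<Rightarrow> real" where
  "covariance M X Y =
     (\<integral>\<omega>. (X \<omega> - (\<integral>\<omega>'. X \<omega>' \<partial>M)) * (Y \<omega> - (\<integral>\<omega>'. Y \<omega>' \<partial>M)) \<partial>M)"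

text \<open>Only the random variables \<open>T x\<close> with \<open>x\<close> on the unit sphere are relevant.\<close>
definition spherical_random_field :: "'w measure \<Rightarrow> (real^3 \<Rightarrow> 'w \<Rightarrow> real) \<Rightarrow> bool" where
  "spherical_random_field M T \<longleftrightarrow>
     prob_space M \<and>
     (\<forall>x\<in>unit_sphere. square_integrable M (T x) \<and> (\<integral>\<omega>. T x \<omega> \<partial>M) = 0) \<and>
     continuous_on (unit_sphere \<times> unit_sphere) (\<lambda>(x, y). covariance M (T x) (T y)) \<and>
     \<not> (\<lambda>(x, y). covariance M (T x) (T y)) constant_on (unit_sphere \<times> unit_sphere)"

definition point_of_isotropy :: "'w measure \<Rightarrow> (real^3 \<Rightarrow> 'w \<Rightarrow> real) \<Rightarrow> real^3 \<Rightarrow> bool" where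
  "point_of_isotropy M T x0 \<longleftrightarrow>
     x0 \<in> unit_sphere \<and>
     (\<exists>B::real \<Rightarrow> real. \<forall>x\<in>unit_sphere. covariance M (T x0) (T x) = B (gc_dist x0 x))"

text \<open>The coefficient \<open>a\<^bsub>lm\<^esub>\<close>, the integral of \<open>T Y\<^bsub>lm\<^esub>\<^sup>*\<close> against the surface measure
  \<open>sin \<theta> d\<theta> d\<phi>\<close>.\<close>
definition laplace_coeff :: "'w measure \<Rightarrow> (real^3 \<Rightarrow> 'w \<Rightarrow> real) \<Rightarrow> nat \<Rightarrow> int \<Rightarrow> 'w \<Rightarrow> complex" where
  "laplace_coeff M T l m =
     ms_integral M (0, 0) (pi, 2 * pi)
       (\<lambda>(\<theta>, \<phi>) \<omega>. complex_of_real (sin \<theta>) *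
          (complex_of_real (T (sphere_point \<theta> \<phi>) \<omega>) * cnj (sph_harm l m (sphere_point \<theta> \<phi>))))"

text \<open>The argument order \<open>l l' m m'\<close> follows the index order in \<open>C\<^bsub>ll'mm'\<^esub>\<close>.\<close>
definition spectrum ::
  "'w measure \<Rightarrow> (real^3 \<Rightarrow> 'w \<Rightarrow> real) \<Rightarrow> nat \<Rightarrow> nat \<Rightarrow> int \<Rightarrow> int \<Rightarrow> complex" where
  "spectrum M T l l' m m' =
     (\<integral>\<omega>. laplace_coeff M T l m \<omega> * cnj (laplace_coeff M T l' m' \<omega>) \<partial>M)"

definition laplace_partial_sum ::
  "'w measure \<Rightarrow> (real^3 \<Rightarrow> 'w \<Rightarrow> real) \<Rightarrow> real^3 \<Rightarrow> nat \<Rightarrow> 'w \<Rightarrow> complex" where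
  "laplace_partial_sum M T x L \<omega> =
     (\<Sum>l\<le>L. \<Sum>m\<in>{- int l..int l}. laplace_coeff M T l m \<omega> * sph_harm l m x)"

end

theory Submission
  imports Defs
begin

text \<open>At the pole only the harmonics of order \<open>0\<close> survive, with
  \<open>Y\<^bsub>l0\<^esub>(\<^bold>0) = sqrt ((2l+1)/(4\<pi>))\<close>. Pairing the Laplace series of \<open>T(\<^bold>0)\<close> with
  \<open>a\<^bsub>l'm'\<^esub>\<close> therefore gives
  \<open>\<Sum>\<^sub>l sqrt (2l+1) C\<^bsub>ll'0m'\<^esub> = sqrt (4\<pi>) E(T(\<^bold>0) a\<^bsub>l'm'\<^esub>\<^sup>*)\<close>, and the condition says that
  \<open>T(\<^bold>0)\<close> is orthogonal to all \<open>a\<^bsub>l'm'\<^esub>\<close> with \<open>m' \<noteq> 0\<close>. Under isotropy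
  \<open>E(T(\<^bold>0) a\<^bsub>l'm'\<^esub>\<^sup>*)\<close> is the integral of \<open>B(\<theta>) Y\<^bsub>l'm'\<^esub>\<close>, which vanishes by integrating
  over the longitude first. Conversely, pairing \<open>T(\<^bold>0)\<close> with the Laplace series of \<open>T(\<^bold>x)\<close> leaves
  only terms of order \<open>0\<close>, which depend on the colatitude of \<open>\<^bold>x\<close> alone.

  The coefficients are defined by \<open>SOME\<close>, so the mean-square integrals must be shown to exist: the
  Riemann sums of a mean-square uniformly continuous family are Cauchy, and \<open>L\<^sup>2\<close> is complete.\<close>

section \<open>Square-integrable random variables\<close>

lemma norm_add_power2_le:
  fixes x y :: "'b::real_normed_vector"
  shows "(norm (x + y))\<^sup>2 \<le> 2 * (norm x)\<^sup>2 + 2 * (norm y)\<^sup>2"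
proof -
  have "(norm (x + y))\<^sup>2 \<le> (norm x + norm y)\<^sup>2"
    by (simp add: norm_triangle_ineq power_mono)
  also have "\<dots> \<le> 2 * (norm x)\<^sup>2 + 2 * (norm y)\<^sup>2"
    using sum_squares_bound[of "norm x" "norm y"] by (simp add: power2_sum)
  finally show ?thesis .
qed

lemma square_integrable_add:
  assumes "square_integrable M X" "square_integrable M Y"
  shows "square_integrable M (\<lambda>\<omega>. X \<omega> + Y \<omega>)"
proof -
  have [measurable]: "X \<in> borel_measurable M" "Y \<in> borel_measurable M"
    using assms by (auto simp: square_integrable_def)
  have "integrable M (\<lambda>\<omega>. (norm (X \<omega> + Y \<omega>))\<^sup>2)"
  proof (rule Bochner_Integration.integrable_bound)
    show "integrable M (\<lambda>\<omega>. 2 * (norm (X \<omega>))\<^sup>2 + 2 * (norm (Y \<omega>))\<^sup>2)"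
      using assms by (auto simp: square_integrable_def)
  qed (auto intro!: AE_I2 norm_add_power2_le)
  then show ?thesis by (simp add: square_integrable_def)
qed

lemma square_integrable_scaleR:
  assumes "square_integrable M X"
  shows "square_integrable M (\<lambda>\<omega>. c *\<^sub>R X \<omega>)"
  using assms by (auto simp: square_integrable_def power_mult_distrib)

lemma square_integrable_mult:
  fixes X :: "'w \<Rightarrow> complex"
  assumes "square_integrable M X"
  shows "square_integrable M (\<lambda>\<omega>. c * X \<omega>)"
  using assms by (auto simp: square_integrable_def norm_mult power_mult_distrib)

lemma square_integrable_diff:
  assumes "square_integrable M X" "square_integrable M Y"
  shows "square_integrable M (\<lambda>\<omega>. X \<omega> - Y \<omega>)"
  using square_integrable_add[OF assms(1) square_integrable_scaleR[OF assms(2), of "-1"]] by simp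

lemma square_integrable_sum:
  assumes "\<And>i. i \<in> A \<Longrightarrow> square_integrable M (X i)"
  shows "square_integrable M (\<lambda>\<omega>. \<Sum>i\<in>A. X i \<omega>)"
  using assms
proof (induction A rule: infinite_finite_induct)
  case (insert a A)
  then show ?case by (simp add: square_integrable_add)
qed (auto simp: square_integrable_def)

section \<open>Inner products, the Cauchy-Schwarz inequality and completeness of L2\<close>

lemma square_integrable_integrable_mult_cnj:
  fixes X Y :: "'w \<Rightarrow> complex"
  assumes "square_integrable M X" "square_integrable M Y"
  shows "integrable M (\<lambda>\<omega>. X \<omega> * cnj (Y \<omega>))"
proof (rule Bochner_Integration.integrable_bound)
  show "integrable M (\<lambda>\<omega>. (norm (X \<omega>))\<^sup>2 + (norm (Y \<omega>))\<^sup>2)"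
    using assms by (auto simp: square_integrable_def)
  show "(\<lambda>\<omega>. X \<omega> * cnj (Y \<omega>)) \<in> borel_measurable M"
    using assms by (auto simp: square_integrable_def intro!: borel_measurable_times
        borel_measurable_continuous_on[of cnj] continuous_intros)
  show "AE \<omega> in M. norm (X \<omega> * cnj (Y \<omega>)) \<le> norm ((norm (X \<omega>))\<^sup>2 + (norm (Y \<omega>))\<^sup>2)"
  proof (rule AE_I2)
    fix \<omega>
    \<comment> \<open>The inequality 2ab \<le> a^2 + b^2 makes the sum of the squared norms an
      integrable majorant of the product.\<close>
    have "2 * (norm (X \<omega>) * norm (Y \<omega>)) \<le> (norm (X \<omega>))\<^sup>2 + (norm (Y \<omega>))\<^sup>2"
      using sum_squares_bound[of "norm (X \<omega>)" "norm (Y \<omega>)"] by simp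
    moreover have "0 \<le> norm (X \<omega>) * norm (Y \<omega>)" by simp
    ultimately show "norm (X \<omega> * cnj (Y \<omega>)) \<le> norm ((norm (X \<omega>))\<^sup>2 + (norm (Y \<omega>))\<^sup>2)"
      unfolding norm_mult complex_mod_cnj real_norm_def by linarith
  qed
qed

text \<open>The inequality for nonnegative extended integrals is applied to the two norms.
  Integrability of their product and of their squares carries it over to Bochner integrals.\<close>

lemma integral_Cauchy_Schwarz:
  fixes X Y :: "'w \<Rightarrow> complex"
  assumes X: "square_integrable M X" and Y: "square_integrable M Y"
  shows "(norm (\<integral>\<omega>. X \<omega> * cnj (Y \<omega>) \<partial>M))\<^sup>2
    \<le> (\<integral>\<omega>. (norm (X \<omega>))\<^sup>2 \<partial>M) * (\<integral>\<omega>. (norm (Y \<omega>))\<^sup>2 \<partial>M)"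
proof -
  have mX: "(\<lambda>\<omega>. norm (X \<omega>)) \<in> borel_measurable M" and mY: "(\<lambda>\<omega>. norm (Y \<omega>)) \<in> borel_measurable M"
    and iX: "integrable M (\<lambda>\<omega>. (norm (X \<omega>))\<^sup>2)" and iY: "integrable M (\<lambda>\<omega>. (norm (Y \<omega>))\<^sup>2)"
    using assms by (auto simp: square_integrable_def)
  have int: "integrable M (\<lambda>\<omega>. norm (X \<omega>) * norm (Y \<omega>))"
    using integrable_norm[OF square_integrable_integrable_mult_cnj[OF X Y]] by (simp add: norm_mult)
  let ?I = "\<integral>\<omega>. norm (X \<omega>) * norm (Y \<omega>) \<partial>M"
  have I0: "0 \<le> ?I" by simp
  have "(\<integral>\<^sup>+\<omega>. ennreal (norm (X \<omega>)) * ennreal (norm (Y \<omega>)) \<partial>M)\<^sup>2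
     \<le> (\<integral>\<^sup>+\<omega>. (ennreal (norm (X \<omega>)))\<^sup>2 \<partial>M) * (\<integral>\<^sup>+\<omega>. (ennreal (norm (Y \<omega>)))\<^sup>2 \<partial>M)"
    using mX mY by (intro Cauchy_Schwarz_nn_integral) auto
  moreover have "(\<integral>\<^sup>+\<omega>. ennreal (norm (X \<omega>)) * ennreal (norm (Y \<omega>)) \<partial>M) = ennreal ?I"
    using int by (subst nn_integral_eq_integral[symmetric]) (auto simp: ennreal_mult)
  moreover have "(\<integral>\<^sup>+\<omega>. (ennreal (norm (X \<omega>)))\<^sup>2 \<partial>M) = ennreal (\<integral>\<omega>. (norm (X \<omega>))\<^sup>2 \<partial>M)"
    using iX by (subst nn_integral_eq_integral[symmetric]) (auto simp: ennreal_power)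
  moreover have "(\<integral>\<^sup>+\<omega>. (ennreal (norm (Y \<omega>)))\<^sup>2 \<partial>M) = ennreal (\<integral>\<omega>. (norm (Y \<omega>))\<^sup>2 \<partial>M)"
    using iY by (subst nn_integral_eq_integral[symmetric]) (auto simp: ennreal_power)
  ultimately have "ennreal (?I\<^sup>2) \<le> ennreal ((\<integral>\<omega>. (norm (X \<omega>))\<^sup>2 \<partial>M) * (\<integral>\<omega>. (norm (Y \<omega>))\<^sup>2 \<partial>M))"
    using I0 by (simp add: ennreal_power ennreal_mult)
  then have le: "?I\<^sup>2 \<le> (\<integral>\<omega>. (norm (X \<omega>))\<^sup>2 \<partial>M) * (\<integral>\<omega>. (norm (Y \<omega>))\<^sup>2 \<partial>M)"
    by (subst (asm) ennreal_le_iff) auto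
  have "norm (\<integral>\<omega>. X \<omega> * cnj (Y \<omega>) \<partial>M) \<le> ?I"
    using integral_norm_bound[of M "\<lambda>\<omega>. X \<omega> * cnj (Y \<omega>)"] by (simp add: norm_mult)
  then have "(norm (\<integral>\<omega>. X \<omega> * cnj (Y \<omega>) \<partial>M))\<^sup>2 \<le> ?I\<^sup>2"
    by (simp add: power_mono)
  with le show ?thesis by linarith
qed

text \<open>Completeness of L2 in Riesz-Fischer form: a geometric rate makes the sequence itself
  converge almost everywhere, without passing to a subsequence, and Fatou's lemma hands the same
  rate to the limit.\<close>

lemma L2_fast_Cauchy_convergent:
  fixes X :: "nat \<Rightarrow> 'w \<Rightarrow> 'b::{banach, second_countable_topology}"
  assumes X: "\<And>n. square_integrable M (X n)"
    and fast: "\<And>m n. n \<le> m \<Longrightarrow> (\<integral>\<omega>. (norm (X n \<omega> - X m \<omega>))\<^sup>2 \<partial>M) \<le> (1/4) ^ n"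
  obtains Y where "square_integrable M Y"
    and "\<And>n. (\<integral>\<omega>. (norm (X n \<omega> - Y \<omega>))\<^sup>2 \<partial>M) \<le> (1/4) ^ n"
proof -
  have [measurable]: "X n \<in> borel_measurable M" for n
    using X by (auto simp: square_integrable_def)
  have nn: "(\<integral>\<^sup>+\<omega>. ennreal ((norm (X n \<omega> - X m \<omega>))\<^sup>2) \<partial>M) \<le> ennreal ((1/4) ^ n)" if "n \<le> m" for m n
    using square_integrable_diff[OF X X, of n m] fast[OF that]
    by (subst nn_integral_eq_integral) (auto simp: square_integrable_def intro: ennreal_leI)
  \<comment> \<open>The squared increments have integral at most 4^-n, so weighting them by 2^n
    still leaves a convergent series of integrals. Hence the weighted series is finite almost
    everywhere.\<close>
  define d where "d n \<omega> = norm (X (Suc n) \<omega> - X n \<omega>)" for n \<omega>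
  have [measurable]: "d n \<in> borel_measurable M" for n
    unfolding d_def by measurable
  have "(\<integral>\<^sup>+\<omega>. (\<Sum>n. ennreal (2 ^ n * (d n \<omega>)\<^sup>2)) \<partial>M) = (\<Sum>n. \<integral>\<^sup>+\<omega>. ennreal (2 ^ n * (d n \<omega>)\<^sup>2) \<partial>M)"
    by (intro nn_integral_suminf) auto
  also have "\<dots> \<le> (\<Sum>n. ennreal ((1/2) ^ n))"
  proof (intro suminf_le)
    fix n
    have "(\<integral>\<^sup>+\<omega>. ennreal (2 ^ n * (d n \<omega>)\<^sup>2) \<partial>M) = ennreal (2 ^ n) * (\<integral>\<^sup>+\<omega>. ennreal ((norm (X n \<omega> - X (Suc n) \<omega>))\<^sup>2) \<partial>M)"
      by (subst nn_integral_cmult[symmetric]) (auto simp: ennreal_mult d_def norm_minus_commute)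
    also have "\<dots> \<le> ennreal (2 ^ n) * ennreal ((1/4) ^ n)"
      by (intro mult_left_mono nn) auto
    also have "\<dots> = ennreal ((1/2) ^ n)"
      by (simp add: ennreal_mult[symmetric] power_mult_distrib[symmetric])
    finally show "(\<integral>\<^sup>+\<omega>. ennreal (2 ^ n * (d n \<omega>)\<^sup>2) \<partial>M) \<le> ennreal ((1/2) ^ n)" .
  qed auto
  also have "\<dots> < \<infinity>"
    by (subst suminf_ennreal2) (auto intro: summable_geometric)
  finally have "AE \<omega> in M. (\<Sum>n. ennreal (2 ^ n * (d n \<omega>)\<^sup>2)) \<noteq> \<infinity>"
    by (intro nn_integral_PInf_AE) auto
  then have lim: "AE \<omega> in M. (\<lambda>m. X m \<omega>) \<longlonglongrightarrow> lim (\<lambda>m. X m \<omega>)"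
  proof (rule AE_mp[OF _ AE_I2], intro impI)
    fix \<omega> assume "(\<Sum>n. ennreal (2 ^ n * (d n \<omega>)\<^sup>2)) \<noteq> \<infinity>"
    then have "summable (\<lambda>n. 2 ^ n * (d n \<omega>)\<^sup>2)"
      by (intro summable_suminf_not_top) auto
    then have sum: "summable (\<lambda>n. (1/2) ^ n + 2 ^ n * (d n \<omega>)\<^sup>2)"
      by (intro summable_add) (auto intro: summable_geometric)
    \<comment> \<open>Passes from squared increments to increments: if d exceeds 2^-n then 2^n d
      \<ge> 1, so d \<le> 2^n d^2. The increments are therefore absolutely summable and telescope to
      a limit.\<close>
    have "d n \<omega> \<le> (1/2) ^ n + 2 ^ n * (d n \<omega>)\<^sup>2" for n
    proof (cases "d n \<omega> \<le> (1/2) ^ n")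
      case False
      then have "1 * d n \<omega> \<le> (2 ^ n * d n \<omega>) * d n \<omega>"
        by (intro mult_right_mono) (auto simp: d_def field_simps power_divide)
      then show ?thesis by (simp add: power2_eq_square mult.assoc add_increasing)
    qed (simp add: add_increasing2)
    then have "summable (\<lambda>n. X (Suc n) \<omega> - X n \<omega>)"
      by (intro summable_comparison_test[OF _ sum]) (auto simp: d_def)
    then have "convergent (\<lambda>m. \<Sum>n<m. X (Suc n) \<omega> - X n \<omega>)"
      by (simp add: summable_iff_convergent)
    then have "convergent (\<lambda>m. X m \<omega> - X 0 \<omega>)"
      by (simp only: sum_lessThan_telescope[of "\<lambda>n. X n \<omega>"])
    from convergent_add[OF this convergent_const[of "X 0 \<omega>"]] show "(\<lambda>m. X m \<omega>) \<longlonglongrightarrow> lim (\<lambda>m. X m \<omega>)"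
      by (simp add: convergent_LIMSEQ_iff)
  qed
  \<comment> \<open>\<open>lim\<close> is total, so \<open>Y\<close> is defined and measurable
    everywhere. Its value is the actual limit outside a null set.\<close>
  define Y where "Y \<omega> = lim (\<lambda>m. X m \<omega>)" for \<omega>
  have [measurable]: "Y \<in> borel_measurable M"
    unfolding Y_def by measurable
  \<comment> \<open>Here n stays fixed while m tends to infinity; the bound 4^-n for all m \<ge> n
    survives the lower limit.\<close>
  have Fatou: "(\<integral>\<^sup>+\<omega>. ennreal ((norm (X n \<omega> - Y \<omega>))\<^sup>2) \<partial>M) \<le> ennreal ((1/4) ^ n)" for n
  proof -
    have "(\<integral>\<^sup>+\<omega>. ennreal ((norm (X n \<omega> - Y \<omega>))\<^sup>2) \<partial>M)
        = (\<integral>\<^sup>+\<omega>. liminf (\<lambda>m. ennreal ((norm (X n \<omega> - X m \<omega>))\<^sup>2)) \<partial>M)"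
    proof (rule nn_integral_cong_AE, rule AE_mp[OF lim AE_I2], intro impI)
      fix \<omega> assume "(\<lambda>m. X m \<omega>) \<longlonglongrightarrow> lim (\<lambda>m. X m \<omega>)"
      then have "(\<lambda>m. ennreal ((norm (X n \<omega> - X m \<omega>))\<^sup>2)) \<longlonglongrightarrow> ennreal ((norm (X n \<omega> - Y \<omega>))\<^sup>2)"
        unfolding Y_def by (intro tendsto_intros)
      then show "ennreal ((norm (X n \<omega> - Y \<omega>))\<^sup>2) = liminf (\<lambda>m. ennreal ((norm (X n \<omega> - X m \<omega>))\<^sup>2))"
        by (rule lim_imp_Liminf[OF trivial_limit_sequentially, symmetric])
    qed
    also have "\<dots> \<le> liminf (\<lambda>m. \<integral>\<^sup>+\<omega>. ennreal ((norm (X n \<omega> - X m \<omega>))\<^sup>2) \<partial>M)"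
      by (intro nn_integral_liminf) auto
    also have "\<dots> \<le> ennreal ((1/4) ^ n)"
    proof -
      have "liminf (\<lambda>m. \<integral>\<^sup>+\<omega>. ennreal ((norm (X n \<omega> - X m \<omega>))\<^sup>2) \<partial>M) \<le> liminf (\<lambda>m. ennreal ((1/4) ^ n))"
        by (intro Liminf_mono eventually_sequentiallyI[of n] nn)
      then show ?thesis by (simp add: Liminf_const)
    qed
    finally show ?thesis .
  qed
  have diff: "square_integrable M (\<lambda>\<omega>. X n \<omega> - Y \<omega>)" for n
  proof -
    have "integrable M (\<lambda>\<omega>. (norm (X n \<omega> - Y \<omega>))\<^sup>2)"
      using Fatou[of n] by (intro integrableI_bounded) (auto simp: le_less_trans)
    then show ?thesis by (simp add: square_integrable_def)
  qed
  show thesis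
  proof
    \<comment> \<open>Y is written as X 0 - (X 0 - Y), a difference of two square-integrable
      functions.\<close>
    show "square_integrable M Y"
      using square_integrable_diff[OF X diff, of 0 0] by simp
    show "(\<integral>\<omega>. (norm (X n \<omega> - Y \<omega>))\<^sup>2 \<partial>M) \<le> (1/4) ^ n" for n
    proof -
      have "ennreal (\<integral>\<omega>. (norm (X n \<omega> - Y \<omega>))\<^sup>2 \<partial>M) = (\<integral>\<^sup>+\<omega>. ennreal ((norm (X n \<omega> - Y \<omega>))\<^sup>2) \<partial>M)"
        using diff[of n] by (subst nn_integral_eq_integral) (auto simp: square_integrable_def)
      also note Fatou[of n]
      finally show ?thesis by (subst (asm) ennreal_le_iff) auto
    qed
  qed
qed

text \<open>Continuity of the inner product in its conjugated argument: by Cauchy-Schwarz the error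
  is at most the norm of Z times the L2 distance.\<close>

lemma converges_in_L2_inner:
  fixes X :: "nat \<Rightarrow> 'w \<Rightarrow> complex"
  assumes X: "converges_in_L2 M X Y" and Z: "square_integrable M Z"
  shows "(\<lambda>n. \<integral>\<omega>. Z \<omega> * cnj (X n \<omega>) \<partial>M) \<longlonglongrightarrow> (\<integral>\<omega>. Z \<omega> * cnj (Y \<omega>) \<partial>M)"
proof -
  have sq: "\<And>n. square_integrable M (X n)" "square_integrable M Y"
    and lim: "(\<lambda>n. \<integral>\<omega>. (norm (X n \<omega> - Y \<omega>))\<^sup>2 \<partial>M) \<longlonglongrightarrow> 0"
    using X by (auto simp: converges_in_L2_def)
  define K where "K = (\<integral>\<omega>. (norm (Z \<omega>))\<^sup>2 \<partial>M)"
  let ?d = "\<lambda>n. (\<integral>\<omega>. Z \<omega> * cnj (X n \<omega>) \<partial>M) - (\<integral>\<omega>. Z \<omega> * cnj (Y \<omega>) \<partial>M)"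
  have bound: "norm (?d n) \<le> sqrt (K * (\<integral>\<omega>. (norm (X n \<omega> - Y \<omega>))\<^sup>2 \<partial>M))" for n
  proof (rule real_le_rsqrt)
    have "?d n = (\<integral>\<omega>. Z \<omega> * cnj (X n \<omega> - Y \<omega>) \<partial>M)"
      using square_integrable_integrable_mult_cnj[OF Z sq(1)] square_integrable_integrable_mult_cnj[OF Z sq(2)]
      by (simp add: right_diff_distrib)
    then show "(norm (?d n))\<^sup>2 \<le> K * (\<integral>\<omega>. (norm (X n \<omega> - Y \<omega>))\<^sup>2 \<partial>M)"
      unfolding K_def by (simp only: integral_Cauchy_Schwarz Z square_integrable_diff sq)
  qed
  have "(\<lambda>n. sqrt (K * (\<integral>\<omega>. (norm (X n \<omega> - Y \<omega>))\<^sup>2 \<partial>M))) \<longlonglongrightarrow> sqrt (K * 0)"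
    by (intro tendsto_intros lim)
  then have "?d \<longlonglongrightarrow> 0"
    by (intro Lim_null_comparison[OF always_eventually, of ?d]) (auto intro: bound)
  then show ?thesis by (simp add: LIM_zero_iff)
qed

section \<open>Mean-square integrals\<close>

lemma sum_content_Int_tagged_division:
  fixes a b :: "'n::euclidean_space"
  assumes D: "D tagged_division_of cbox a b" and sub: "cbox u v \<subseteq> cbox a b"
  shows "(\<Sum>(x, k)\<in>D. measure lborel (cbox u v \<inter> k)) = measure lborel (cbox u v)"
proof -
  \<comment> \<open>The indicator of the small box is integrated over the large box. Additivity of
    the integral over the division splits this into the overlaps with the tiles.\<close>
  let ?f = "\<lambda>x. if x \<in> cbox u v then 1 else (0::real)"
  have eq: "integral (cbox c d) ?f = measure lborel (cbox u v \<inter> cbox c d)" for c d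
  proof -
    \<comment> \<open>An intersection of boxes is again a box, so the integral of 1 over it is its
      content.\<close>
    obtain p q where pq: "cbox u v \<inter> cbox c d = cbox p q" unfolding Int_interval by blast
    have "integral (cbox c d) ?f = integral (cbox u v \<inter> cbox c d) (\<lambda>x. 1)"
      by (rule Henstock_Kurzweil_Integration.integral_restrict_Int)
    also have "\<dots> = measure lborel (cbox u v \<inter> cbox c d)"
      by (simp add: pq)
    finally show ?thesis .
  qed
  have "(\<lambda>x. 1::real) integrable_on (cbox u v \<inter> cbox a b)"
    unfolding inf.absorb1[OF sub] by (rule integrable_const)
  then have "?f integrable_on cbox a b"
    by (rule iffD2[OF integrable_restrict_Int])
  then have "integral (cbox a b) ?f = (\<Sum>(x, k)\<in>D. integral k ?f)"
    using D by (rule integral_combine_tagged_division_topdown)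
  also have "\<dots> = (\<Sum>(x, k)\<in>D. measure lborel (cbox u v \<inter> k))"
  proof (intro sum.cong refl, clarify)
    fix x k assume "(x, k) \<in> D"
    then obtain c d where "k = cbox c d" using tagged_division_ofD(4)[OF D] by metis
    then show "integral k ?f = measure lborel (cbox u v \<inter> k)" using eq by simp
  qed
  finally show ?thesis
    unfolding eq inf.absorb1[OF sub] by simp
qed

text \<open>Both Riemann sums are rewritten over the common refinement \<open>{k \<inter> k'}\<close>.\<close>
lemma ms_riemann_sums_close:
  fixes f :: "'n::euclidean_space \<Rightarrow> 'w \<Rightarrow> 'b::{banach, second_countable_topology}"
  assumes D1: "D1 tagged_division_of cbox a b" and D2: "D2 tagged_division_of cbox a b"
    and f: "\<And>s. s \<in> cbox a b \<Longrightarrow> square_integrable M (f s)"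
    and close: "\<And>s k t k'. (s, k) \<in> D1 \<Longrightarrow> (t, k') \<in> D2 \<Longrightarrow> k \<inter> k' \<noteq> {} \<Longrightarrow>
      (\<integral>\<omega>. (norm (f s \<omega> - f t \<omega>))\<^sup>2 \<partial>M) \<le> e"
  shows "(\<integral>\<omega>. (norm ((\<Sum>(s, k)\<in>D1. measure lborel k *\<^sub>R f s \<omega>)
      - (\<Sum>(t, k)\<in>D2. measure lborel k *\<^sub>R f t \<omega>)))\<^sup>2 \<partial>M) \<le> (measure lborel (cbox a b))\<^sup>2 * e"
proof -
  let ?V = "measure lborel (cbox a b)"
  \<comment> \<open>A pair of tiles, one from each division, gets the content of its overlap as
    weight; \<open>d\<close> compares the values at the two tags.\<close>
  define W where "W z = measure lborel (snd (fst z) \<inter> snd (snd z))" for z :: "('n \<times> 'n set) \<times> ('n \<times> 'n set)"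
  define d where "d z \<omega> = f (fst (fst z)) \<omega> - f (fst (snd z)) \<omega>" for z :: "('n \<times> 'n set) \<times> ('n \<times> 'n set)" and \<omega>
  have W0: "0 \<le> W z" for z by (simp add: W_def)
  \<comment> \<open>Stated for arbitrary \<open>D\<close> and \<open>D'\<close> because it is used
    with the two divisions in both orders.\<close>
  have row: "(\<Sum>q\<in>D'. measure lborel (snd p \<inter> snd q)) = measure lborel (snd p)"
    if mem: "p \<in> D" and div: "D tagged_division_of cbox a b" and div': "D' tagged_division_of cbox a b" for p D D'
  proof -
    have "\<exists>u v. snd p = cbox u v" "snd p \<subseteq> cbox a b"
      using mem tagged_division_ofD(3,4)[OF div, of "fst p" "snd p"] by simp_all
    then obtain u v where "snd p = cbox u v" "cbox u v \<subseteq> cbox a b" by metis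
    then show ?thesis
      using sum_content_Int_tagged_division[OF div', of u v] by (simp add: case_prod_unfold)
  qed
  have S1: "(\<Sum>(s, k)\<in>D1. measure lborel k *\<^sub>R f s \<omega>) = (\<Sum>z\<in>D1 \<times> D2. W z *\<^sub>R f (fst (fst z)) \<omega>)" for \<omega>
  proof -
    have "(\<Sum>p\<in>D1. measure lborel (snd p) *\<^sub>R f (fst p) \<omega>)
       = (\<Sum>p\<in>D1. \<Sum>q\<in>D2. measure lborel (snd p \<inter> snd q) *\<^sub>R f (fst p) \<omega>)"
      by (intro sum.cong refl) (simp add: scaleR_sum_left[symmetric] row[OF _ D1 D2])
    then show ?thesis
      by (simp add: sum.cartesian_product case_prod_unfold W_def)
  qed
  have S2: "(\<Sum>(t, k)\<in>D2. measure lborel k *\<^sub>R f t \<omega>) = (\<Sum>z\<in>D1 \<times> D2. W z *\<^sub>R f (fst (snd z)) \<omega>)" for \<omega>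
  proof -
    have "(\<Sum>q\<in>D2. measure lborel (snd q) *\<^sub>R f (fst q) \<omega>)
       = (\<Sum>q\<in>D2. \<Sum>p\<in>D1. measure lborel (snd q \<inter> snd p) *\<^sub>R f (fst q) \<omega>)"
      by (intro sum.cong refl) (simp add: scaleR_sum_left[symmetric] row[OF _ D2 D1])
    also have "\<dots> = (\<Sum>p\<in>D1. \<Sum>q\<in>D2. measure lborel (snd q \<inter> snd p) *\<^sub>R f (fst q) \<omega>)"
      by (rule sum.swap)
    finally show ?thesis
      by (simp add: sum.cartesian_product case_prod_unfold W_def Int_commute)
  qed
  have sumW: "(\<Sum>z\<in>D1 \<times> D2. W z) = ?V"
  proof -
    have "(\<Sum>z\<in>D1 \<times> D2. W z) = (\<Sum>p\<in>D1. \<Sum>q\<in>D2. measure lborel (snd p \<inter> snd q))"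
      by (simp add: sum.cartesian_product case_prod_unfold W_def)
    also have "\<dots> = (\<Sum>p\<in>D1. measure lborel (snd p))"
      by (intro sum.cong refl row[OF _ D1 D2])
    also have "\<dots> = ?V"
      using additive_content_tagged_division[OF D1] by (simp add: case_prod_unfold)
    finally show ?thesis .
  qed
  have d: "square_integrable M (d z)" if "z \<in> D1 \<times> D2" for z
  proof -
    have "fst (fst z) \<in> cbox a b" "fst (snd z) \<in> cbox a b"
      using that tag_in_interval[OF D1] tag_in_interval[OF D2] by auto
    then show ?thesis unfolding d_def by (intro square_integrable_diff f)
  qed
  \<comment> \<open>Each weight is split as sqrt W times sqrt W before applying Cauchy-Schwarz to
    the finite sum. The first factor is then the total weight, which is the content of the
    box.\<close>
  have pt: "(norm ((\<Sum>(s, k)\<in>D1. measure lborel k *\<^sub>R f s \<omega>) - (\<Sum>(t, k)\<in>D2. measure lborel k *\<^sub>R f t \<omega>)))\<^sup>2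
      \<le> ?V * (\<Sum>z\<in>D1 \<times> D2. W z * (norm (d z \<omega>))\<^sup>2)" for \<omega>
  proof -
    have "(\<Sum>(s, k)\<in>D1. measure lborel k *\<^sub>R f s \<omega>) - (\<Sum>(t, k)\<in>D2. measure lborel k *\<^sub>R f t \<omega>)
        = (\<Sum>z\<in>D1 \<times> D2. W z *\<^sub>R d z \<omega>)"
      unfolding S1 S2 d_def by (simp add: sum_subtractf scaleR_diff_right)
    also have "norm \<dots> \<le> (\<Sum>z\<in>D1 \<times> D2. sqrt (W z) * (sqrt (W z) * norm (d z \<omega>)))"
      by (rule order.trans[OF norm_sum])
        (auto intro!: sum_mono simp: W0 mult.assoc[symmetric])
    finally have "(norm ((\<Sum>(s, k)\<in>D1. measure lborel k *\<^sub>R f s \<omega>) - (\<Sum>(t, k)\<in>D2. measure lborel k *\<^sub>R f t \<omega>)))\<^sup>2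
      \<le> (\<Sum>z\<in>D1 \<times> D2. sqrt (W z) * (sqrt (W z) * norm (d z \<omega>)))\<^sup>2"
      by (simp add: power_mono)
    also have "\<dots> \<le> (\<Sum>z\<in>D1 \<times> D2. (sqrt (W z))\<^sup>2) * (\<Sum>z\<in>D1 \<times> D2. (sqrt (W z) * norm (d z \<omega>))\<^sup>2)"
      by (rule Cauchy_Schwarz_ineq_sum)
    finally show ?thesis by (simp add: W0 power_mult_distrib sumW)
  qed
  have dint: "integrable M (\<lambda>\<omega>. (norm (d z \<omega>))\<^sup>2)" if "z \<in> D1 \<times> D2" for z
    using d[OF that] by (simp add: square_integrable_def)
  have "(\<integral>\<omega>. (norm ((\<Sum>(s, k)\<in>D1. measure lborel k *\<^sub>R f s \<omega>)
      - (\<Sum>(t, k)\<in>D2. measure lborel k *\<^sub>R f t \<omega>)))\<^sup>2 \<partial>M)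
      \<le> (\<integral>\<omega>. ?V * (\<Sum>z\<in>D1 \<times> D2. W z * (norm (d z \<omega>))\<^sup>2) \<partial>M)"
    using dint by (intro integral_mono' pt integrable_mult_right integrable_sum) (auto simp: sum_nonneg W0)
  also have "\<dots> = ?V * (\<Sum>z\<in>D1 \<times> D2. W z * (\<integral>\<omega>. (norm (d z \<omega>))\<^sup>2 \<partial>M))"
    using dint by (simp add: Bochner_Integration.integral_sum)
  also have "\<dots> \<le> ?V * (\<Sum>z\<in>D1 \<times> D2. W z * e)"
  proof (rule mult_left_mono[OF sum_mono])
    fix z assume "z \<in> D1 \<times> D2"
    then obtain s k t k' where z: "z = ((s, k), (t, k'))" "(s, k) \<in> D1" "(t, k') \<in> D2" by auto
    show "W z * (\<integral>\<omega>. (norm (d z \<omega>))\<^sup>2 \<partial>M) \<le> W z * e"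
    \<comment> \<open>Disjoint tiles have weight 0, so closeness of the values is needed only for
      tiles that meet.\<close>
    proof (cases "k \<inter> k' = {}")
      case True then show ?thesis by (simp add: W_def z)
    next
      case False
      then show ?thesis using close[OF z(2,3)] by (intro mult_left_mono W0) (simp add: d_def z)
    qed
  qed auto
  also have "\<dots> = ?V\<^sup>2 * e"
    by (simp add: sum_distrib_right[symmetric] sumW power2_eq_square)
  finally show ?thesis .
qed

text \<open>A Cauchy argument: uniform mean-square continuity makes any two sufficiently fine
  Riemann sums close. A sequence of ever finer divisions then has an L2 limit, and every other fine
  division is compared with a member of that sequence.\<close>

lemma has_ms_integral_exists:
  fixes f :: "'n::euclidean_space \<Rightarrow> 'w \<Rightarrow> 'b::{banach, second_countable_topology}"
  assumes f: "\<And>s. s \<in> cbox a b \<Longrightarrow> square_integrable M (f s)"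
    and cont: "\<And>e. e > 0 \<Longrightarrow> \<exists>d>0. \<forall>s\<in>cbox a b. \<forall>t\<in>cbox a b. dist s t < d \<longrightarrow>
      (\<integral>\<omega>. (norm (f s \<omega> - f t \<omega>))\<^sup>2 \<partial>M) < e"
  shows "\<exists>I. has_ms_integral M f I a b"
proof -
  let ?V = "measure lborel (cbox a b)"
  let ?S = "\<lambda>D \<omega>. \<Sum>(s, k)\<in>D. measure lborel k *\<^sub>R f s \<omega>"
  \<comment> \<open>The divisor offsets the factor V^2 lost when comparing Riemann sums; adding 1
    keeps it positive even for a box of content 0.\<close>
  let ?P = "\<lambda>n d. d > 0 \<and> (\<forall>s\<in>cbox a b. \<forall>t\<in>cbox a b. dist s t < d \<longrightarrow>
      (\<integral>\<omega>. (norm (f s \<omega> - f t \<omega>))\<^sup>2 \<partial>M) < (1/4) ^ n / (?V\<^sup>2 + 1))"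
  have "\<forall>n::nat. \<exists>d. ?P n d"
    by (intro allI cont divide_pos_pos add_nonneg_pos) auto
  then obtain d where d: "\<And>n::nat. ?P n (d n)"
    using choice[of ?P] by blast
  then have d0: "d n > 0" for n by blast
  \<comment> \<open>The minimum makes the radii nonincreasing, so later divisions are fine for all
    earlier gauges. The half is there because the tags of two meeting tiles are each within \<delta>
    of a common point.\<close>
  define \<delta> where "\<delta> n = Min (d ` {..n}) / 2" for n
  have \<delta>0: "\<delta> n > 0" for n unfolding \<delta>_def using d0 by auto
  have \<delta>_le: "\<delta> n \<le> d n / 2" for n unfolding \<delta>_def by (auto intro!: divide_right_mono)
  have \<delta>_anti: "\<delta> m \<le> \<delta> n" if "n \<le> m" for m n
    unfolding \<delta>_def using that by (intro divide_right_mono Min_antimono) auto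
  have gauge: "gauge (\<lambda>x::'n. ball x (\<delta> n))" for n
    using \<delta>0 by (intro gauge_ball_dependent) auto
  have sq: "square_integrable M (?S D)" if "D tagged_division_of cbox a b" for D
    unfolding case_prod_unfold
    using tag_in_interval[OF that] by (intro square_integrable_sum square_integrable_scaleR f) auto
  have close: "(\<integral>\<omega>. (norm (?S D1 \<omega> - ?S D2 \<omega>))\<^sup>2 \<partial>M) \<le> (1/4) ^ n"
    if D1: "D1 tagged_division_of cbox a b" "(\<lambda>x. ball x (\<delta> n)) fine D1"
      and D2: "D2 tagged_division_of cbox a b" "(\<lambda>x. ball x (\<delta> n)) fine D2" for D1 D2 n
  proof -
    have "(\<integral>\<omega>. (norm (?S D1 \<omega> - ?S D2 \<omega>))\<^sup>2 \<partial>M) \<le> ?V\<^sup>2 * ((1/4) ^ n / (?V\<^sup>2 + 1))"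
    proof (rule ms_riemann_sums_close[OF D1(1) D2(1) f])
      fix s k t k' assume *: "(s, k) \<in> D1" "(t, k') \<in> D2" "k \<inter> k' \<noteq> {}"
      then obtain x where "x \<in> k" "x \<in> k'" by auto
      then have "dist s x < \<delta> n" "dist t x < \<delta> n"
        using fineD[OF D1(2) *(1)] fineD[OF D2(2) *(2)] by auto
      then have "dist s t < d n"
        using dist_triangle2[of s t x] \<delta>_le[of n] by linarith
      then show "(\<integral>\<omega>. (norm (f s \<omega> - f t \<omega>))\<^sup>2 \<partial>M) \<le> (1/4) ^ n / (?V\<^sup>2 + 1)"
        using d[of n] tag_in_interval[OF D1(1) *(1)] tag_in_interval[OF D2(1) *(2)] by (intro less_imp_le) blast
    qed
    also have "\<dots> \<le> (1/4) ^ n"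
    proof -
      have "?V\<^sup>2 / (?V\<^sup>2 + 1) \<le> 1" by (simp add: divide_le_eq add_nonneg_pos)
      then have "(1/4) ^ n * (?V\<^sup>2 / (?V\<^sup>2 + 1)) \<le> (1/4::real) ^ n * 1"
        by (intro mult_left_mono) auto
      then show ?thesis by (simp add: mult.commute)
    qed
    finally show ?thesis .
  qed
  have "\<exists>P. \<forall>n. P n tagged_division_of cbox a b \<and> (\<lambda>x. ball x (\<delta> n)) fine P n"
  proof (rule choice, rule allI)
    show "\<exists>P. P tagged_division_of cbox a b \<and> (\<lambda>x. ball x (\<delta> n)) fine P" for n
      by (rule fine_division_exists[OF gauge]) blast
  qed
  then obtain P where "\<forall>n. P n tagged_division_of cbox a b \<and> (\<lambda>x. ball x (\<delta> n)) fine P n" ..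
  then have P: "\<And>n. P n tagged_division_of cbox a b" "\<And>n. (\<lambda>x. ball x (\<delta> n)) fine P n"
    by simp_all
  have P': "(\<lambda>x. ball x (\<delta> n)) fine P m" if "n \<le> m" for m n
    unfolding fine_def
  proof clarify
    fix x k y assume "(x, k) \<in> P m" "y \<in> k"
    then show "y \<in> ball x (\<delta> n)"
      using fineD[OF P(2)] \<delta>_anti[OF that] by force
  qed
  have fast: "(\<integral>\<omega>. (norm (?S (P n) \<omega> - ?S (P m) \<omega>))\<^sup>2 \<partial>M) \<le> (1/4) ^ n" if "n \<le> m" for m n
    by (rule close[OF P(1) P(2) P(1) P'[OF that]])
  obtain I where I: "square_integrable M I"
    and lim: "\<And>n. (\<integral>\<omega>. (norm (?S (P n) \<omega> - I \<omega>))\<^sup>2 \<partial>M) \<le> (1/4) ^ n"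
    by (rule L2_fast_Cauchy_convergent[of M "\<lambda>n. ?S (P n)", OF sq[OF P(1)] fast]) (assumption, rule that)
  have "has_ms_integral M f I a b"
    unfolding has_ms_integral_def
  proof (intro conjI allI impI ballI f I)
    fix e :: real assume "e > 0"
    \<comment> \<open>The two errors are each at most 4^-n, and the inequality |x + y|^2 \<le>
      2|x|^2 + 2|y|^2 doubles both; this accounts for e/4.\<close>
    then obtain n where n: "(1/4) ^ n < e / 4"
      using real_arch_pow_inv[of "e / 4" "1/4"] by auto
    show "\<exists>\<gamma>. gauge \<gamma> \<and> (\<forall>D. D tagged_division_of cbox a b \<and> \<gamma> fine D \<longrightarrow>
        (\<integral>\<omega>. (norm (?S D \<omega> - I \<omega>))\<^sup>2 \<partial>M) < e)"
    proof (intro exI conjI allI impI, rule gauge[of n], elim conjE)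
      fix D assume D: "D tagged_division_of cbox a b" "(\<lambda>x. ball x (\<delta> n)) fine D"
      have sq1: "square_integrable M (\<lambda>\<omega>. ?S D \<omega> - ?S (P n) \<omega>)"
        by (intro square_integrable_diff sq D P)
      have sq2: "square_integrable M (\<lambda>\<omega>. ?S (P n) \<omega> - I \<omega>)"
        by (intro square_integrable_diff sq I P)
      have int1: "integrable M (\<lambda>\<omega>. (norm (?S D \<omega> - ?S (P n) \<omega>))\<^sup>2)"
        and int2: "integrable M (\<lambda>\<omega>. (norm (?S (P n) \<omega> - I \<omega>))\<^sup>2)"
        using sq1 sq2 unfolding square_integrable_def by blast+
      have "(\<integral>\<omega>. (norm (?S D \<omega> - I \<omega>))\<^sup>2 \<partial>M)
          \<le> (\<integral>\<omega>. 2 * (norm (?S D \<omega> - ?S (P n) \<omega>))\<^sup>2 + 2 * (norm (?S (P n) \<omega> - I \<omega>))\<^sup>2 \<partial>M)"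
      proof (rule integral_mono')
        show "integrable M (\<lambda>\<omega>. 2 * (norm (?S D \<omega> - ?S (P n) \<omega>))\<^sup>2 + 2 * (norm (?S (P n) \<omega> - I \<omega>))\<^sup>2)"
          using int1 int2 by (intro Bochner_Integration.integrable_add integrable_mult_right)
        show "(norm (?S D \<omega> - I \<omega>))\<^sup>2 \<le> 2 * (norm (?S D \<omega> - ?S (P n) \<omega>))\<^sup>2 + 2 * (norm (?S (P n) \<omega> - I \<omega>))\<^sup>2" for \<omega>
          using norm_add_power2_le[of "?S D \<omega> - ?S (P n) \<omega>" "?S (P n) \<omega> - I \<omega>"]
          unfolding diff_add_cancel add_diff_eq .
      qed simp
      also have "\<dots> = 2 * (\<integral>\<omega>. (norm (?S D \<omega> - ?S (P n) \<omega>))\<^sup>2 \<partial>M) + 2 * (\<integral>\<omega>. (norm (?S (P n) \<omega> - I \<omega>))\<^sup>2 \<partial>M)"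
        using int1 int2 by (subst Bochner_Integration.integral_add) (auto intro!: integrable_mult_right)
      also have "\<dots> \<le> 2 * (1/4) ^ n + 2 * (1/4) ^ n"
        by (intro add_mono mult_left_mono close[OF D P] lim) auto
      also have "\<dots> < e" using n by simp
      finally show "(\<integral>\<omega>. (norm (?S D \<omega> - I \<omega>))\<^sup>2 \<partial>M) < e" .
    qed
  qed
  then show ?thesis by (rule exI[of _ I])
qed

text \<open>Pairing with a fixed Z is additive on Riemann sums and continuous in L2. It thus turns
  the mean-square integral into an ordinary gauge integral, through which the coefficients become
  accessible to calculation.\<close>

lemma has_ms_integral_inner:
  fixes f :: "'n::euclidean_space \<Rightarrow> 'w \<Rightarrow> complex"
  assumes I: "has_ms_integral M f I a b" and Z: "square_integrable M Z"
  shows "((\<lambda>s. \<integral>\<omega>. Z \<omega> * cnj (f s \<omega>) \<partial>M) has_integral (\<integral>\<omega>. Z \<omega> * cnj (I \<omega>) \<partial>M)) (cbox a b)"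
  unfolding has_integral
proof (intro allI impI)
  fix e :: real assume e: "e > 0"
  let ?S = "\<lambda>D \<omega>. \<Sum>(s, k)\<in>D. measure lborel k *\<^sub>R f s \<omega>"
  define K where "K = (\<integral>\<omega>. (norm (Z \<omega>))\<^sup>2 \<partial>M)"
  have K: "K \<ge> 0" by (simp add: K_def)
  have f: "square_integrable M (f s)" if "s \<in> cbox a b" for s
    using I that by (simp add: has_ms_integral_def)
  have sqI: "square_integrable M I"
    using I by (simp add: has_ms_integral_def)
  \<comment> \<open>Cauchy-Schwarz multiplies the squared error by K, and K / (K + 1) < 1; adding 1
    also covers K = 0.\<close>
  have "e\<^sup>2 / (K + 1) > 0" using e K by (intro divide_pos_pos) auto
  then obtain \<gamma> where \<gamma>: "gauge \<gamma>"
    and fine: "\<And>D. D tagged_division_of cbox a b \<Longrightarrow> \<gamma> fine D \<Longrightarrow>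
      (\<integral>\<omega>. (norm (?S D \<omega> - I \<omega>))\<^sup>2 \<partial>M) < e\<^sup>2 / (K + 1)"
    using I unfolding has_ms_integral_def by meson
  show "\<exists>\<gamma>. gauge \<gamma> \<and> (\<forall>D. D tagged_division_of cbox a b \<and> \<gamma> fine D \<longrightarrow>
      norm ((\<Sum>(s, k)\<in>D. measure lborel k *\<^sub>R (\<integral>\<omega>. Z \<omega> * cnj (f s \<omega>) \<partial>M)) - (\<integral>\<omega>. Z \<omega> * cnj (I \<omega>) \<partial>M)) < e)"
  proof (intro exI conjI allI impI, rule \<gamma>, elim conjE)
    fix D assume D: "D tagged_division_of cbox a b" "\<gamma> fine D"
    have tag: "fst p \<in> cbox a b" if "p \<in> D" for p
      using that tag_in_interval[OF D(1)] by (cases p) auto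
    have sqS: "square_integrable M (?S D)"
      unfolding case_prod_unfold by (intro square_integrable_sum square_integrable_scaleR f tag)
    have "(\<integral>\<omega>. Z \<omega> * cnj (?S D \<omega>) \<partial>M)
        = (\<integral>\<omega>. (\<Sum>p\<in>D. measure lborel (snd p) *\<^sub>R (Z \<omega> * cnj (f (fst p) \<omega>))) \<partial>M)"
      by (simp add: case_prod_unfold sum_distrib_left)
    also have "\<dots> = (\<Sum>p\<in>D. \<integral>\<omega>. measure lborel (snd p) *\<^sub>R (Z \<omega> * cnj (f (fst p) \<omega>)) \<partial>M)"
      using tag by (intro Bochner_Integration.integral_sum integrable_scaleR_right
          square_integrable_integrable_mult_cnj Z f)
    finally have "(\<Sum>(s, k)\<in>D. measure lborel k *\<^sub>R (\<integral>\<omega>. Z \<omega> * cnj (f s \<omega>) \<partial>M))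
        = (\<integral>\<omega>. Z \<omega> * cnj (?S D \<omega>) \<partial>M)"
      by (simp only: case_prod_unfold integral_scaleR_right)
    then have eq: "(\<Sum>(s, k)\<in>D. measure lborel k *\<^sub>R (\<integral>\<omega>. Z \<omega> * cnj (f s \<omega>) \<partial>M)) - (\<integral>\<omega>. Z \<omega> * cnj (I \<omega>) \<partial>M)
        = (\<integral>\<omega>. Z \<omega> * cnj (?S D \<omega> - I \<omega>) \<partial>M)"
      using square_integrable_integrable_mult_cnj[OF Z sqS] square_integrable_integrable_mult_cnj[OF Z sqI]
      by (simp only: complex_cnj_diff right_diff_distrib Bochner_Integration.integral_diff)
    have "(norm (\<integral>\<omega>. Z \<omega> * cnj (?S D \<omega> - I \<omega>) \<partial>M))\<^sup>2 \<le> K * (\<integral>\<omega>. (norm (?S D \<omega> - I \<omega>))\<^sup>2 \<partial>M)"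
      unfolding K_def by (intro integral_Cauchy_Schwarz Z square_integrable_diff sqS sqI)
    also have "\<dots> \<le> K * (e\<^sup>2 / (K + 1))"
      using fine[OF D] K by (intro mult_left_mono) auto
    also have "\<dots> < e\<^sup>2"
      using e K by (simp add: field_simps)
    finally have "norm (\<integral>\<omega>. Z \<omega> * cnj (?S D \<omega> - I \<omega>) \<partial>M) < e"
      by (rule power2_less_imp_less) (use e in simp)
    then show "norm ((\<Sum>(s, k)\<in>D. measure lborel k *\<^sub>R (\<integral>\<omega>. Z \<omega> * cnj (f s \<omega>) \<partial>M)) - (\<integral>\<omega>. Z \<omega> * cnj (I \<omega>) \<partial>M)) < e"
      unfolding eq .
  qed
qed

section \<open>Spherical harmonics\<close>

lemma poly_pderiv_power_linear_mult:
  fixes a :: real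
  shows "poly ((pderiv ^^ n) ([:-a, 1:] ^ n * q)) a = fact n * poly q a"
proof (induction n arbitrary: q)
  case (Suc n)
  \<comment> \<open>One derivative uses up one factor x - a and replaces q by (n+1) q + (x - a) q',
    whose value at a is (n+1) q(a). This is why the induction leaves q arbitrary.\<close>
  have "pderiv ([:-a, 1:] ^ Suc n * q) = [:-a, 1:] ^ n * (smult (of_nat (Suc n)) q + [:-a, 1:] * pderiv q)"
    unfolding pderiv_mult pderiv_power_Suc
    by (simp add: pderiv_pCons algebra_simps)
  then have "poly ((pderiv ^^ Suc n) ([:-a, 1:] ^ Suc n * q)) a
      = poly ((pderiv ^^ n) ([:-a, 1:] ^ n * (smult (of_nat (Suc n)) q + [:-a, 1:] * pderiv q))) a"
    by (simp only: funpow_Suc_right o_apply)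
  then show ?case unfolding Suc.IH by simp
qed simp

text \<open>Factoring x^2 - 1 = (x - 1)(x + 1), the l-th derivative at 1 is l! 2^l, which the
  normalisation in Rodrigues' formula cancels.\<close>

lemma poly_legendre_1: "poly (legendre l) 1 = 1"
proof -
  have "[:-1, 0, 1:] ^ l = [:-1, 1:] ^ l * [:1, 1::real:] ^ l"
    by (simp add: power_mult_distrib[symmetric])
  then have "poly ((pderiv ^^ l) ([:-1, 0, 1::real:] ^ l)) 1 = fact l * 2 ^ l"
    using poly_pderiv_power_linear_mult[of l 1 "[:1, 1:] ^ l"] by simp
  then show ?thesis by (simp add: legendre_def)
qed

text \<open>The real factor that remains of a spherical harmonic once its longitudinal phase is
  split off. The sign for m < 0 comes from the convention relating orders m and -m, so one formula
  serves both signs.\<close>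

definition sph_amplitude :: "nat \<Rightarrow> int \<Rightarrow> real \<Rightarrow> real" where
  "sph_amplitude l m \<theta> = (if m \<ge> 0 then 1 else (-1) ^ nat (-m)) *
     (sqrt ((2 * real l + 1) * fact (l - nat \<bar>m\<bar>) / (4 * pi * fact (l + nat \<bar>m\<bar>)))
      * assoc_legendre l (nat \<bar>m\<bar>) (cos \<theta>))"

lemma sph_harm_eq_cis:
  "sph_harm l m x = cis (of_int m * longitude x) * complex_of_real (sph_amplitude l m (colatitude x))"
proof (cases "m \<ge> 0")
  case True
  then show ?thesis
    by (simp add: sph_harm_def sph_harm_nonneg_def sph_amplitude_def)
next
  case False
  then have "real (nat (-m)) = - real_of_int m" "nat \<bar>m\<bar> = nat (-m)" by simp_all
  with False show ?thesis
    by (simp add: sph_harm_def sph_harm_nonneg_def sph_amplitude_def cis_cnj)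
qed

lemma continuous_sph_amplitude: "continuous_on A (sph_amplitude l m)"
  unfolding sph_amplitude_def assoc_legendre_def by (intro continuous_intros)

text \<open>The associated Legendre function at cos \<theta> carries the factor |sin \<theta>|^|m|,
  with positive exponent when m is nonzero.\<close>

lemma sph_amplitude_sin_eq_0: "sin \<theta> = 0 \<Longrightarrow> m \<noteq> 0 \<Longrightarrow> sph_amplitude l m \<theta> = 0"
  by (simp add: sph_amplitude_def assoc_legendre_def sin_squared_eq[symmetric] zero_power)

section \<open>Spherical coordinates and the harmonics expressed in them\<close>

lemma sphere_point_nth [simp]:
  "sphere_point \<theta> \<phi> $ 1 = sin \<theta> * cos \<phi>" "sphere_point \<theta> \<phi> $ 2 = sin \<theta> * sin \<phi>"
  "sphere_point \<theta> \<phi> $ 3 = cos \<theta>"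
  by (simp_all add: sphere_point_def)

lemma north_pole_nth [simp]: "north_pole $ 1 = 0" "north_pole $ 2 = 0" "north_pole $ 3 = 1"
  by (simp_all add: north_pole_def)

lemma sphere_point_in_unit_sphere: "sphere_point \<theta> \<phi> \<in> unit_sphere"
proof -
  have "(sin \<theta> * cos \<phi>)\<^sup>2 + (sin \<theta> * sin \<phi>)\<^sup>2 + (cos \<theta>)\<^sup>2 = 1"
    by (simp add: power_mult_distrib sin_squared_eq algebra_simps)
  then have "sphere_point \<theta> \<phi> \<bullet> sphere_point \<theta> \<phi> = 1"
    by (simp add: inner_vec_def sum_3 power2_eq_square)
  then show ?thesis by (simp add: norm_eq_sqrt_inner)
qed

lemma north_pole_in_unit_sphere: "north_pole \<in> unit_sphere"
  by (simp add: norm_eq_sqrt_inner inner_vec_def sum_3)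

lemma gc_dist_north_pole: "gc_dist north_pole x = colatitude x"
  by (simp add: gc_dist_def colatitude_def inner_vec_def sum_3)

lemma colatitude_sphere_point: "0 \<le> \<theta> \<Longrightarrow> \<theta> \<le> pi \<Longrightarrow> colatitude (sphere_point \<theta> \<phi>) = \<theta>"
  by (simp add: colatitude_def arccos_cos)

lemma continuous_sphere_point: "continuous_on A (\<lambda>s. sphere_point (fst s) (snd s))"
proof -
  have "continuous_on A (\<lambda>s. \<chi> i. sphere_point (fst s) (snd s) $ i)"
  proof (rule continuous_on_vec_lambda)
    fix i :: 3
    show "continuous_on A (\<lambda>s. sphere_point (fst s) (snd s) $ i)"
      using exhaust_3[of i] by (elim disjE; simp; intro continuous_intros)
  qed
  then show ?thesis by simp
qed

text \<open>At the poles and on the seam \<open>\<phi> = 2\<pi>\<close>, where \<open>\<phi>\<close> is not the longitude, the identity holds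
  because the amplitude vanishes or because \<open>cis\<close> is periodic.\<close>
lemma sph_harm_sphere_point:
  assumes "0 \<le> \<theta>" "\<theta> \<le> pi" "0 \<le> \<phi>" "\<phi> \<le> 2 * pi"
  shows "sph_harm l m (sphere_point \<theta> \<phi>) = cis (of_int m * \<phi>) * complex_of_real (sph_amplitude l m \<theta>)"
proof -
  have "cis (of_int m * longitude (sphere_point \<theta> \<phi>)) = cis (of_int m * \<phi>)"
    if "m \<noteq> 0" "sin \<theta> \<noteq> 0"
  proof -
    have s: "sin \<theta> > 0" using assms sin_ge_zero[of \<theta>] that by linarith
    have "longitude (sphere_point \<theta> \<phi>) = (if \<phi> = 2 * pi then 0 else \<phi>)"
      unfolding longitude_def
      by (rule Arg2pi_unique[of "sin \<theta>"]) (use s assms in \<open>auto simp: complex_eq_iff cis_conv_exp[symmetric]\<close>)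
    moreover have "cis (of_int m * (2 * pi)) = 1"
      using cis_multiple_2pi[of "of_int m"] by (simp add: mult.commute)
    ultimately show ?thesis by simp
  qed
  then show ?thesis
    unfolding sph_harm_eq_cis colatitude_sphere_point[OF assms(1,2)]
    using sph_amplitude_sin_eq_0[of \<theta> m l] by (cases "m = 0"; cases "sin \<theta> = 0") simp_all
qed

lemma sph_harm_north_pole:
  "sph_harm l m north_pole = (if m = 0 then complex_of_real (sqrt ((2 * real l + 1) / (4 * pi))) else 0)"
proof -
  have "colatitude north_pole = 0" by (simp add: colatitude_def)
  then show ?thesis
    unfolding sph_harm_eq_cis using sph_amplitude_sin_eq_0[of 0 m l]
    by (simp add: sph_amplitude_def assoc_legendre_def poly_legendre_1)
qed

lemma integral_cis_multiple_period:
  assumes "m \<noteq> 0"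
  shows "integral {0..2 * pi} (\<lambda>\<phi>. cis (of_int m * \<phi>)) = 0"
proof -
  \<comment> \<open>An antiderivative, taken on the complex plane so that complex differentiation
    rules apply. It takes equal values at both ends of the period, and m \<noteq> 0 permits the
    division.\<close>
  let ?F = "\<lambda>z. exp (\<i> * of_int m * z) / (\<i> * of_int m)"
  have F: "?F (complex_of_real \<phi>) = cis (of_int m * \<phi>) / (\<i> * of_int m)" for \<phi>
    by (simp add: cis_conv_exp mult.assoc)
  have "((\<lambda>\<phi>. cis (of_int m * \<phi>)) has_integral
      (?F (complex_of_real (2 * pi)) - ?F (complex_of_real 0))) {0..2 * pi}"
  proof (rule fundamental_theorem_of_calculus)
    show "((\<lambda>\<phi>. ?F (complex_of_real \<phi>)) has_vector_derivative cis (of_int m * \<phi>)) (at \<phi> within {0..2 * pi})" for \<phi>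
      using assms by (intro has_vector_derivative_real_field)
        (auto intro!: derivative_eq_intros simp: cis_conv_exp mult.assoc)
  qed simp
  moreover have "cis (of_int m * (2 * pi)) = 1"
    using cis_multiple_2pi[of "of_int m"] by (simp add: mult.commute)
  ultimately show ?thesis unfolding F by (simp add: integral_unique)
qed

section \<open>Spherical random fields\<close>

lemma square_integrable_of_real:
  fixes X :: "'w \<Rightarrow> real"
  assumes "square_integrable M X"
  shows "square_integrable M (\<lambda>\<omega>. complex_of_real (X \<omega>))"
  using assms by (auto simp: square_integrable_def)

lemma spherical_random_field_square_integrable:
  "spherical_random_field M T \<Longrightarrow> x \<in> unit_sphere \<Longrightarrow> square_integrable M (\<lambda>\<omega>. complex_of_real (T x \<omega>))"
  by (auto simp: spherical_random_field_def intro!: square_integrable_of_real)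

lemma spherical_random_field_covariance:
  "spherical_random_field M T \<Longrightarrow> x \<in> unit_sphere \<Longrightarrow> y \<in> unit_sphere \<Longrightarrow>
    (\<integral>\<omega>. complex_of_real (T x \<omega>) * cnj (complex_of_real (T y \<omega>)) \<partial>M) = complex_of_real (covariance M (T x) (T y))"
  by (simp add: spherical_random_field_def covariance_def flip: of_real_mult)

text \<open>On the parameter box the longitude, which jumps at the seam, gives way to the coordinate
  \<phi>; the deterministic factor becomes visibly continuous in both coordinates.\<close>

lemma laplace_integrand_eq:
  assumes "(\<theta>, \<phi>) \<in> cbox (0, 0) (pi, 2 * pi)"
  shows "complex_of_real (sin \<theta>) * (complex_of_real t * cnj (sph_harm l m (sphere_point \<theta> \<phi>)))
    = complex_of_real (sin \<theta> * sph_amplitude l m \<theta>) * cis (- (of_int m * \<phi>)) * complex_of_real t"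
  using assms by (subst sph_harm_sphere_point) (auto simp: cbox_Pair_eq cis_cnj)

text \<open>Makes the choice by \<open>SOME\<close> meaningful. The squared mean-square distance
  between two values of the integrand is a combination of covariances, hence uniformly continuous on
  the compact square of the parameter box.\<close>

lemma laplace_coeff_has_ms_integral:
  assumes "spherical_random_field M T"
  shows "has_ms_integral M (\<lambda>(\<theta>, \<phi>) \<omega>. complex_of_real (sin \<theta>) *
          (complex_of_real (T (sphere_point \<theta> \<phi>) \<omega>) * cnj (sph_harm l m (sphere_point \<theta> \<phi>))))
     (laplace_coeff M T l m) (0, 0) (pi, 2 * pi)"
    (is "has_ms_integral M ?f _ _ _")
proof -
  let ?B = "cbox (0::real, 0::real) (pi, 2 * pi)"
  define c where "c s = complex_of_real (sin (fst s) * sph_amplitude l m (fst s)) * cis (- (of_int m * snd s))"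
    for s :: "real \<times> real"
  define p where "p s = sphere_point (fst s) (snd s)" for s :: "real \<times> real"
  define K where "K s t = covariance M (T (p s)) (T (p t))" for s t
  \<comment> \<open>The second-moment kernel of the integrand on the box: the covariance of the
    field with both deterministic factors attached.\<close>
  define H where "H s t = c s * cnj (c t) * complex_of_real (K s t)" for s t
  have f_eq: "?f s = (\<lambda>\<omega>. c s * complex_of_real (T (p s) \<omega>))" if "s \<in> ?B" for s
    using that laplace_integrand_eq[of "fst s" "snd s"] by (simp add: case_prod_unfold c_def p_def fun_eq_iff)
  have p: "p s \<in> unit_sphere" for s
    unfolding p_def by (rule sphere_point_in_unit_sphere)
  have sq: "square_integrable M (\<lambda>\<omega>. c s * complex_of_real (T (p s) \<omega>))" for s
    by (intro square_integrable_mult spherical_random_field_square_integrable assms p)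
  have contc: "continuous_on A c" for A
    unfolding c_def
    by (intro continuous_intros continuous_on_compose2[OF continuous_sph_amplitude]) auto
  have contp: "continuous_on A p" for A
    unfolding p_def by (rule continuous_sphere_point)
  have contK: "continuous_on A (\<lambda>z. K (fst z) (snd z))" for A
  proof -
    have cov: "continuous_on (unit_sphere \<times> unit_sphere) (\<lambda>(x, y). covariance M (T x) (T y))"
      using assms by (simp only: spherical_random_field_def)
    have fst: "continuous_on A (\<lambda>z. p (fst z))" and snd: "continuous_on A (\<lambda>z. p (snd z))"
      by (rule continuous_on_compose2[OF contp[of UNIV]], auto intro: continuous_intros)+
    have "continuous_on A (\<lambda>z. (\<lambda>(x, y). covariance M (T x) (T y)) (p (fst z), p (snd z)))"
      by (rule continuous_on_compose2[OF cov continuous_on_Pair[OF fst snd]]) (use p in blast)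
    then show ?thesis by (simp add: K_def)
  qed
  have contH: "continuous_on A (\<lambda>z. H (g z) (h z))" if "continuous_on A g" "continuous_on A h" for A g h
  proof -
    have K: "continuous_on A (\<lambda>z. K (fst (g z, h z)) (snd (g z, h z)))"
      by (rule continuous_on_compose2[OF contK[of UNIV] continuous_on_Pair[OF that]]) simp
    have cg: "continuous_on A (\<lambda>z. c (g z))" and ch: "continuous_on A (\<lambda>z. c (h z))"
      by (rule continuous_on_compose2[OF contc[of UNIV]], use that in simp_all)+
    show ?thesis
      unfolding H_def using K by (intro continuous_intros cg ch) simp
  qed
  \<comment> \<open>The squared mean-square distance expanded in terms of \<open>H\<close>, so that
    its continuity follows from that of \<open>H\<close>.\<close>
  define G where "G z = Re (H (fst z) (fst z) - H (fst z) (snd z) - H (snd z) (fst z) + H (snd z) (snd z))" for z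
  have G: "(\<integral>\<omega>. (norm (c s * complex_of_real (T (p s) \<omega>) - c t * complex_of_real (T (p t) \<omega>)))\<^sup>2 \<partial>M) = G (s, t)" for s t
  proof -
    let ?X = "\<lambda>s \<omega>. c s * complex_of_real (T (p s) \<omega>)"
    have int: "integrable M (\<lambda>\<omega>. ?X s \<omega> * cnj (?X t \<omega>))" for s t
      by (intro square_integrable_integrable_mult_cnj sq)
    have H: "(\<integral>\<omega>. ?X s \<omega> * cnj (?X t \<omega>) \<partial>M) = H s t" for s t
    proof -
      have "(\<integral>\<omega>. ?X s \<omega> * cnj (?X t \<omega>) \<partial>M)
          = (\<integral>\<omega>. (c s * cnj (c t)) * (complex_of_real (T (p s) \<omega>) * cnj (complex_of_real (T (p t) \<omega>))) \<partial>M)"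
        by (rule Bochner_Integration.integral_cong) (simp_all add: mult_ac)
      also have "\<dots> = (c s * cnj (c t)) * (\<integral>\<omega>. complex_of_real (T (p s) \<omega>) * cnj (complex_of_real (T (p t) \<omega>)) \<partial>M)"
        by (intro Bochner_Integration.integral_mult_right square_integrable_integrable_mult_cnj
            spherical_random_field_square_integrable assms p)
      finally show ?thesis
        unfolding spherical_random_field_covariance[OF assms p p] by (simp only: H_def K_def)
    qed
    have "complex_of_real (\<integral>\<omega>. (norm (?X s \<omega> - ?X t \<omega>))\<^sup>2 \<partial>M)
        = (\<integral>\<omega>. (?X s \<omega> - ?X t \<omega>) * cnj (?X s \<omega> - ?X t \<omega>) \<partial>M)"
      unfolding integral_complex_of_real[symmetric] complex_norm_square ..
    also have "\<dots> = (\<integral>\<omega>. ?X s \<omega> * cnj (?X s \<omega>) - ?X s \<omega> * cnj (?X t \<omega>)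
        - ?X t \<omega> * cnj (?X s \<omega>) + ?X t \<omega> * cnj (?X t \<omega>) \<partial>M)"
      by (rule Bochner_Integration.integral_cong) (simp_all add: algebra_simps)
    also have "\<dots> = H s s - H s t - H t s + H t t"
      unfolding H[symmetric] using int
      by (simp only: Bochner_Integration.integral_add Bochner_Integration.integral_diff
          Bochner_Integration.integrable_add Bochner_Integration.integrable_diff)
    finally show ?thesis unfolding G_def by (metis Re_complex_of_real fst_conv snd_conv)
  qed
  have "uniformly_continuous_on (?B \<times> ?B) G"
    unfolding G_def
    by (intro compact_uniformly_continuous continuous_intros contH compact_Times compact_cbox)
  then have unif: "\<exists>d>0. \<forall>z\<in>?B \<times> ?B. \<forall>z'\<in>?B \<times> ?B. dist z' z < d \<longrightarrow> dist (G z') (G z) < e" if "e > 0" for e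
    using that unfolding uniformly_continuous_on_def by blast
  have "\<exists>I. has_ms_integral M ?f I (0, 0) (pi, 2 * pi)"
  proof (rule has_ms_integral_exists)
    show "square_integrable M (?f s)" if "s \<in> ?B" for s
      unfolding f_eq[OF that] by (rule sq)
    fix e :: real assume "e > 0"
    from unif[OF this] obtain d where d: "d > 0"
      and close: "\<And>z z'. z \<in> ?B \<times> ?B \<Longrightarrow> z' \<in> ?B \<times> ?B \<Longrightarrow> dist z' z < d \<Longrightarrow> dist (G z') (G z) < e"
      by blast
    show "\<exists>d>0. \<forall>s\<in>?B. \<forall>t\<in>?B. dist s t < d \<longrightarrow> (\<integral>\<omega>. (norm (?f s \<omega> - ?f t \<omega>))\<^sup>2 \<partial>M) < e"
    proof (intro exI conjI ballI impI, rule d)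
      fix s t assume s: "s \<in> ?B" and t: "t \<in> ?B" and st: "dist s t < d"
      \<comment> \<open>Comparison with the diagonal, where \<open>G\<close> vanishes: the points
        (s, t) and (t, t) are exactly dist s t apart.\<close>
      have "dist (G (s, t)) (G (t, t)) < e"
        using st by (intro close SigmaI s t) (simp add: dist_Pair_Pair)
      moreover have "G (t, t) = 0" by (simp add: G_def)
      ultimately show "(\<integral>\<omega>. (norm (?f s \<omega> - ?f t \<omega>))\<^sup>2 \<partial>M) < e"
        unfolding f_eq[OF s] f_eq[OF t] G by simp
    qed
  qed
  then show ?thesis
    unfolding laplace_coeff_def ms_integral_def by (rule someI_ex)
qed

lemma laplace_coeff_square_integrable:
  "spherical_random_field M T \<Longrightarrow> square_integrable M (laplace_coeff M T l m)"
  using laplace_coeff_has_ms_integral unfolding has_ms_integral_def by blast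

text \<open>Reduces the correlation of the field at x with a coefficient to an integral of the
  covariance; conjugating the integrand restores the positive sign in the phase.\<close>

lemma laplace_coeff_inner_field_has_integral:
  assumes T: "spherical_random_field M T" and x: "x \<in> unit_sphere"
  shows "((\<lambda>(\<theta>, \<phi>). complex_of_real (sin \<theta> * sph_amplitude l m \<theta> * covariance M (T x) (T (sphere_point \<theta> \<phi>)))
      * cis (of_int m * \<phi>)) has_integral
      (\<integral>\<omega>. complex_of_real (T x \<omega>) * cnj (laplace_coeff M T l m \<omega>) \<partial>M)) (cbox (0, 0) (pi, 2 * pi))"
proof (rule has_integral_eq[OF _ has_ms_integral_inner[OF laplace_coeff_has_ms_integral[OF T]
      spherical_random_field_square_integrable[OF T x]]])
  fix s assume s: "s \<in> cbox (0::real, 0::real) (pi, 2 * pi)"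
  obtain \<theta> \<phi> where s_eq: "s = (\<theta>, \<phi>)" by (cases s)
  let ?c = "complex_of_real (sin \<theta> * sph_amplitude l m \<theta>) * cis (of_int m * \<phi>)"
  let ?p = "sphere_point \<theta> \<phi>"
  have "(\<integral>\<omega>. complex_of_real (T x \<omega>) * cnj (complex_of_real (sin \<theta>) *
          (complex_of_real (T ?p \<omega>) * cnj (sph_harm l m ?p))) \<partial>M)
      = (\<integral>\<omega>. ?c * (complex_of_real (T x \<omega>) * cnj (complex_of_real (T ?p \<omega>))) \<partial>M)"
    unfolding laplace_integrand_eq[OF s[unfolded s_eq]]
    by (rule Bochner_Integration.integral_cong) (simp_all add: cis_cnj mult_ac)
  also have "\<dots> = ?c * (\<integral>\<omega>. complex_of_real (T x \<omega>) * cnj (complex_of_real (T ?p \<omega>)) \<partial>M)"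
    by (intro Bochner_Integration.integral_mult_right square_integrable_integrable_mult_cnj
        spherical_random_field_square_integrable T x sphere_point_in_unit_sphere)
  also have "\<dots> = complex_of_real (sin \<theta> * sph_amplitude l m \<theta> * covariance M (T x) (T ?p)) * cis (of_int m * \<phi>)"
    unfolding spherical_random_field_covariance[OF T x sphere_point_in_unit_sphere] by simp
  finally show "(\<integral>\<omega>. complex_of_real (T x \<omega>) * cnj ((case s of (\<theta>, \<phi>) \<Rightarrow> \<lambda>\<omega>. complex_of_real (sin \<theta>) *
          (complex_of_real (T (sphere_point \<theta> \<phi>) \<omega>) * cnj (sph_harm l m (sphere_point \<theta> \<phi>)))) \<omega>) \<partial>M)
     = (case s of (\<theta>, \<phi>) \<Rightarrow> complex_of_real (sin \<theta> * sph_amplitude l m \<theta> * covariance M (T x) (T (sphere_point \<theta> \<phi>)))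
      * cis (of_int m * \<phi>))"
    unfolding s_eq prod.case .
qed

section \<open>From isotropy to vanishing correlations\<close>

lemma isotropic_inner_laplace_coeff_eq_0:
  assumes T: "spherical_random_field M T" and iso: "point_of_isotropy M T north_pole" and m: "m \<noteq> 0"
  shows "(\<integral>\<omega>. complex_of_real (T north_pole \<omega>) * cnj (laplace_coeff M T l m \<omega>) \<partial>M) = 0"
proof -
  obtain B where B: "\<And>x. x \<in> unit_sphere \<Longrightarrow> covariance M (T north_pole) (T x) = B (colatitude x)"
    using iso unfolding point_of_isotropy_def gc_dist_north_pole by blast
  let ?K = "\<lambda>s. covariance M (T north_pole) (T (sphere_point (fst s) (snd s)))"
  let ?h = "\<lambda>(\<theta>, \<phi>). complex_of_real (sin \<theta> * sph_amplitude l m \<theta> * covariance M (T north_pole) (T (sphere_point \<theta> \<phi>)))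
      * cis (of_int m * \<phi>)"
  let ?B = "cbox (0::real, 0::real) (pi, 2 * pi)"
  have cov: "continuous_on (unit_sphere \<times> unit_sphere) (\<lambda>(x, y). covariance M (T x) (T y))"
    using T by (simp only: spherical_random_field_def)
  have "continuous_on ?B (\<lambda>s. (\<lambda>(x, y). covariance M (T x) (T y)) (north_pole, sphere_point (fst s) (snd s)))"
    by (rule continuous_on_compose2[OF cov continuous_on_Pair[OF continuous_on_const continuous_sphere_point]])
      (use north_pole_in_unit_sphere sphere_point_in_unit_sphere in blast)
  then have K: "continuous_on ?B ?K" by simp
  have "continuous_on ?B (\<lambda>s. sph_amplitude l m (fst s))"
    by (rule continuous_on_compose2[OF continuous_sph_amplitude[of UNIV]]) (auto intro: continuous_intros)
  \<comment> \<open>Continuity of the whole integrand is what allows the double integral to be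
    iterated with the longitude innermost.\<close>
  then have cont: "continuous_on ?B ?h"
    unfolding case_prod_unfold by (intro continuous_intros K)
  have "(\<integral>\<omega>. complex_of_real (T north_pole \<omega>) * cnj (laplace_coeff M T l m \<omega>) \<partial>M) = integral ?B ?h"
    using laplace_coeff_inner_field_has_integral[OF T north_pole_in_unit_sphere]
    by (rule integral_unique[symmetric])
  also have "\<dots> = integral (cbox 0 pi) (\<lambda>\<theta>. integral (cbox 0 (2 * pi)) (\<lambda>\<phi>. ?h (\<theta>, \<phi>)))"
    by (rule integral_prod_continuous[OF cont])
  also have "\<dots> = integral (cbox 0 pi) (\<lambda>\<theta>. 0)"
  proof (rule Henstock_Kurzweil_Integration.integral_cong)
    fix \<theta> :: real assume "\<theta> \<in> cbox 0 pi"
    \<comment> \<open>By isotropy the covariance is constant along a parallel, so only the phase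
      still depends on \<phi>, and it integrates to 0 over a full period.\<close>
    then have "integral (cbox 0 (2 * pi)) (\<lambda>\<phi>. ?h (\<theta>, \<phi>))
       = integral {0..2 * pi} (\<lambda>\<phi>. complex_of_real (sin \<theta> * sph_amplitude l m \<theta> * B \<theta>) * cis (of_int m * \<phi>))"
      by (simp add: B[OF sphere_point_in_unit_sphere] colatitude_sphere_point)
    also have "\<dots> = 0"
      by (simp only: Henstock_Kurzweil_Integration.integral_mult_right integral_cis_multiple_period[OF m] mult_zero_right)
    finally show "integral (cbox 0 (2 * pi)) (\<lambda>\<phi>. ?h (\<theta>, \<phi>)) = 0" .
  qed
  finally show ?thesis by simp
qed

section \<open>The Laplace series at the pole and the spectral series\<close>

lemma laplace_partial_sum_north_pole:
  "laplace_partial_sum M T north_pole L \<omega>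
    = (\<Sum>l\<le>L. complex_of_real (sqrt ((2 * real l + 1) / (4 * pi))) * laplace_coeff M T l 0 \<omega>)"
  unfolding laplace_partial_sum_def sph_harm_north_pole
  by (intro sum.cong refl) (simp add: if_distrib[of "(*) _"] sum.delta' mult.commute cong: if_cong)

lemma spectrum_series_sums:
  assumes T: "spherical_random_field M T"
    and conv: "converges_in_L2 M (laplace_partial_sum M T north_pole) (\<lambda>\<omega>. complex_of_real (T north_pole \<omega>))"
  shows "(\<lambda>l. complex_of_real (sqrt (2 * real l + 1)) * spectrum M T l l' 0 m') sums
    (complex_of_real (sqrt (4 * pi))
      * (\<integral>\<omega>. complex_of_real (T north_pole \<omega>) * cnj (laplace_coeff M T l' m' \<omega>) \<partial>M))"
proof -
  let ?a = "laplace_coeff M T"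
  note sq = laplace_coeff_square_integrable[OF T]
  \<comment> \<open>The convergent sequence has to occupy the conjugated slot of the inner product;
    a final conjugation moves it into the order used by the spectrum.\<close>
  have "(\<lambda>L. \<integral>\<omega>. ?a l' m' \<omega> * cnj (laplace_partial_sum M T north_pole L \<omega>) \<partial>M)
      \<longlonglongrightarrow> (\<integral>\<omega>. ?a l' m' \<omega> * cnj (complex_of_real (T north_pole \<omega>)) \<partial>M)"
    by (rule converges_in_L2_inner[OF conv sq])
  then have "(\<lambda>L. cnj (\<integral>\<omega>. ?a l' m' \<omega> * cnj (laplace_partial_sum M T north_pole L \<omega>) \<partial>M))
      \<longlonglongrightarrow> cnj (\<integral>\<omega>. ?a l' m' \<omega> * cnj (complex_of_real (T north_pole \<omega>)) \<partial>M)"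
    by (rule tendsto_cnj)
  then have "(\<lambda>L. \<integral>\<omega>. laplace_partial_sum M T north_pole L \<omega> * cnj (?a l' m' \<omega>) \<partial>M)
      \<longlonglongrightarrow> (\<integral>\<omega>. complex_of_real (T north_pole \<omega>) * cnj (?a l' m' \<omega>) \<partial>M)"
    by (simp only: Bochner_Integration.integral_cnj[symmetric] complex_cnj_mult complex_cnj_cnj mult.commute)
  moreover have "(\<integral>\<omega>. laplace_partial_sum M T north_pole L \<omega> * cnj (?a l' m' \<omega>) \<partial>M)
      = (\<Sum>l\<le>L. complex_of_real (sqrt ((2 * real l + 1) / (4 * pi))) * spectrum M T l l' 0 m')" for L
  proof -
    have int: "integrable M (\<lambda>\<omega>. ?a l 0 \<omega> * cnj (?a l' m' \<omega>))" for l
      by (intro square_integrable_integrable_mult_cnj sq)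
    have "(\<integral>\<omega>. laplace_partial_sum M T north_pole L \<omega> * cnj (?a l' m' \<omega>) \<partial>M)
      = (\<integral>\<omega>. (\<Sum>l\<le>L. complex_of_real (sqrt ((2 * real l + 1) / (4 * pi))) * (?a l 0 \<omega> * cnj (?a l' m' \<omega>))) \<partial>M)"
      by (simp only: laplace_partial_sum_north_pole sum_distrib_right mult.assoc)
    also have "\<dots> = (\<Sum>l\<le>L. complex_of_real (sqrt ((2 * real l + 1) / (4 * pi))) * spectrum M T l l' 0 m')"
      unfolding spectrum_def using int
      by (simp only: Bochner_Integration.integral_sum Bochner_Integration.integral_mult_right integrable_mult_right)
    finally show ?thesis .
  qed
  ultimately have "(\<lambda>l. complex_of_real (sqrt ((2 * real l + 1) / (4 * pi))) * spectrum M T l l' 0 m') sums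
      (\<integral>\<omega>. complex_of_real (T north_pole \<omega>) * cnj (?a l' m' \<omega>) \<partial>M)"
    by (simp only: sums_def_le)
  then have "(\<lambda>l. complex_of_real (sqrt (4 * pi)) *
        (complex_of_real (sqrt ((2 * real l + 1) / (4 * pi))) * spectrum M T l l' 0 m')) sums
      (complex_of_real (sqrt (4 * pi)) * (\<integral>\<omega>. complex_of_real (T north_pole \<omega>) * cnj (?a l' m' \<omega>) \<partial>M))"
    by (rule sums_mult)
  \<comment> \<open>Multiplying the series by sqrt (4 pi) removes the normalisation of the harmonics
    at the pole and leaves the weights of the spectral condition.\<close>
  moreover have "complex_of_real (sqrt (4 * pi)) * (complex_of_real (sqrt ((2 * real l + 1) / (4 * pi))) * z)
      = complex_of_real (sqrt (2 * real l + 1)) * z" for l z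
    by (simp add: mult.assoc[symmetric] of_real_mult[symmetric] real_sqrt_mult[symmetric] del: of_real_mult)
  ultimately show ?thesis by (simp only:)
qed

text \<open>The Laplace series of T at x, paired with the field at the pole, retains only its
  order-0 terms. The covariance with the pole is thus a limit of functions of the colatitude, which
  is the distance from the pole.\<close>

lemma point_of_isotropyI:
  assumes T: "spherical_random_field M T"
    and conv: "\<And>x. x \<in> unit_sphere \<Longrightarrow>
      converges_in_L2 M (laplace_partial_sum M T x) (\<lambda>\<omega>. complex_of_real (T x \<omega>))"
    and zero: "\<And>l m. m \<noteq> 0 \<Longrightarrow> \<bar>m\<bar> \<le> int l \<Longrightarrow>
      (\<integral>\<omega>. complex_of_real (T north_pole \<omega>) * cnj (laplace_coeff M T l m \<omega>) \<partial>M) = 0"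
  shows "point_of_isotropy M T north_pole"
proof -
  let ?T0 = "\<lambda>\<omega>. complex_of_real (T north_pole \<omega>)"
  let ?e = "\<lambda>l m. \<integral>\<omega>. ?T0 \<omega> * cnj (laplace_coeff M T l m \<omega>) \<partial>M"
  \<comment> \<open>The surviving partial sum as a function of the angle alone; the point x enters
    only through its colatitude.\<close>
  define b where "b \<gamma> L = (\<Sum>l\<le>L. ?e l 0 * complex_of_real (sph_amplitude l 0 \<gamma>))" for \<gamma> L
  note sq0 = spherical_random_field_square_integrable[OF T north_pole_in_unit_sphere]
  have lim: "b (colatitude x) \<longlonglongrightarrow> complex_of_real (covariance M (T north_pole) (T x))"
    if x: "x \<in> unit_sphere" for x
  proof -
    have int: "integrable M (\<lambda>\<omega>. ?T0 \<omega> * cnj (laplace_coeff M T l m \<omega>))" for l m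
      by (intro square_integrable_integrable_mult_cnj sq0 laplace_coeff_square_integrable T)
    have "(\<integral>\<omega>. ?T0 \<omega> * cnj (laplace_partial_sum M T x L \<omega>) \<partial>M) = b (colatitude x) L" for L
    proof -
      have "(\<integral>\<omega>. ?T0 \<omega> * cnj (laplace_partial_sum M T x L \<omega>) \<partial>M)
          = (\<integral>\<omega>. (\<Sum>l\<le>L. \<Sum>m\<in>{- int l..int l}. (?T0 \<omega> * cnj (laplace_coeff M T l m \<omega>)) * cnj (sph_harm l m x)) \<partial>M)"
        by (simp only: laplace_partial_sum_def cnj_sum sum_distrib_left complex_cnj_mult mult.assoc)
      also have "\<dots> = (\<Sum>l\<le>L. \<Sum>m\<in>{- int l..int l}. ?e l m * cnj (sph_harm l m x))"
        using int by (simp only: Bochner_Integration.integral_sum Bochner_Integration.integral_mult_left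
            integrable_mult_left Bochner_Integration.integrable_sum)
      also have "\<dots> = (\<Sum>l\<le>L. \<Sum>m\<in>{- int l..int l}. if m = 0 then ?e l 0 * cnj (sph_harm l 0 x) else 0)"
        using zero by (intro sum.cong refl) auto
      also have "\<dots> = (\<Sum>l\<le>L. ?e l 0 * cnj (sph_harm l 0 x))"
        by (simp add: sum.delta)
      also have "\<dots> = b (colatitude x) L"
        by (simp add: b_def sph_harm_eq_cis)
      finally show ?thesis .
    qed
    then show ?thesis
      using converges_in_L2_inner[OF conv[OF x] sq0]
      unfolding spherical_random_field_covariance[OF T north_pole_in_unit_sphere x] by (simp only:)
  qed
  have "lim (b (colatitude x)) = complex_of_real (covariance M (T north_pole) (T x))"
    if "x \<in> unit_sphere" for x
    by (rule limI[OF lim[OF that]])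
  \<comment> \<open>The witness for the radial function is the real part of the limit of
    \<open>b\<close>; \<open>lim\<close> makes it a total function of the angle.\<close>
  then have "\<forall>x\<in>unit_sphere. covariance M (T north_pole) (T x) = (\<lambda>\<gamma>. Re (lim (b \<gamma>))) (gc_dist north_pole x)"
    unfolding gc_dist_north_pole by simp
  then show ?thesis
    unfolding point_of_isotropy_def
    by (intro conjI north_pole_in_unit_sphere exI[of _ "\<lambda>\<gamma>. Re (lim (b \<gamma>))"])
qed

text \<open>Letting \<open>l'\<close> range over all naturals adds nothing at 0, where no nonzero
  order is admissible. The relation \<open>sums\<close> asserts convergence as well as the value
  0.\<close>

theorem proposition7:
  fixes M :: "'w measure" and T :: "real^3 \<Rightarrow> 'w \<Rightarrow> real"
  assumes "spherical_random_field M T"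
    and "\<And>x. x \<in> unit_sphere \<Longrightarrow>
           converges_in_L2 M (laplace_partial_sum M T x) (\<lambda>\<omega>. complex_of_real (T x \<omega>))"
  shows "point_of_isotropy M T north_pole \<longleftrightarrow>
    (\<forall>l'::nat. \<forall>m'::int. m' \<noteq> 0 \<and> \<bar>m'\<bar> \<le> int l' \<longrightarrow>
       (\<lambda>l. complex_of_real (sqrt (2 * real l + 1)) * spectrum M T l l' 0 m') sums 0)"
proof -
  have "(\<lambda>l. complex_of_real (sqrt (2 * real l + 1)) * spectrum M T l l' 0 m') sums 0 \<longleftrightarrow>
      (\<integral>\<omega>. complex_of_real (T north_pole \<omega>) * cnj (laplace_coeff M T l' m' \<omega>) \<partial>M) = 0" (is "?s sums 0 \<longleftrightarrow> ?E = 0")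
    for l' m'
  proof -
    \<comment> \<open>The series always converges, to a nonzero multiple of \<open>?E\<close>; its
      sum is 0 exactly when the pole value is orthogonal to the coefficient.\<close>
    have sums: "?s sums (complex_of_real (sqrt (4 * pi)) * ?E)"
      by (rule spectrum_series_sums[OF assms(1) assms(2)[OF north_pole_in_unit_sphere]])
    show ?thesis
    proof
      assume "?s sums 0"
      then have "complex_of_real (sqrt (4 * pi)) * ?E = 0"
        by (rule sums_unique2[OF sums])
      then show "?E = 0" by simp
    next
      assume "?E = 0"
      with sums show "?s sums 0" by simp
    qed
  qed
  then show ?thesis
    using isotropic_inner_laplace_coeff_eq_0[OF assms(1)] point_of_isotropyI[OF assms] by blast
qed

end
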